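(* Let $n=2^s\ge 8$, $\zeta=e^{2\pi i/n}$, $K={\mathbf Q}(\zeta)$, $F={\mathbf Q}(\zeta+\zeta^{-1})$, $\underline{\mathcal O}={\mathbf Z}[\zeta+\zeta^{-1}]$, and $p=2+\zeta+\zeta^{-1}$, a generator of the unique prime $\mathfrak p$ of $\underline{\mathcal O}$ above $2$. Let $L$ be a totally complex quadratic extension of $F$ with ring of integers $\mathcal O_L$, and suppose $\mathfrak p\mathcal O_L$ is the square of a principal ideal. Then $L$ is either $K$ or $F(\sqrt{-p})$, and in either case any generator $q$ of the prime of $\mathcal O_L$ above $\mathfrak p$ satisfies $\mathcal O_L=\underline{\mathcal O}[q]$. *)

theory Defs
  imports "HOL-Analysis.Analysis" "HOL-Computational_Algebra.Polynomial"
begin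

definition is_subfield :: "complex set \<Rightarrow> bool" where
  "is_subfield E \<longleftrightarrow> 0 \<in> E \<and> 1 \<in> E \<and>
     (\<forall>x\<in>E. \<forall>y\<in>E. x + y \<in> E \<and> x * y \<in> E) \<and>
     (\<forall>x\<in>E. - x \<in> E) \<and> (\<forall>x\<in>E. x \<noteq> 0 \<longrightarrow> inverse x \<in> E)"

definition field_gen :: "complex set \<Rightarrow> complex set" where
  "field_gen S = \<Inter> {E. is_subfield E \<and> S \<subseteq> E}"

definition quadratic_ext :: "complex set \<Rightarrow> complex set \<Rightarrow> bool" where
  "quadratic_ext L F \<longleftrightarrow> is_subfield L \<and> is_subfield F \<and> F \<subseteq> L \<and>
     (\<exists>b\<in>L. b \<notin> F \<and> L = {x + y * b | x y. x \<in> F \<and> y \<in> F})"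

definition totally_complex :: "complex set \<Rightarrow> bool" where
  "totally_complex L \<longleftrightarrow> \<not> (\<exists>\<sigma> :: complex \<Rightarrow> real. \<sigma> 1 = 1 \<and>
     (\<forall>x\<in>L. \<forall>y\<in>L. \<sigma> (x + y) = \<sigma> x + \<sigma> y \<and> \<sigma> (x * y) = \<sigma> x * \<sigma> y))"

definition ring_of_integers :: "complex set \<Rightarrow> complex set" where
  "ring_of_integers L = {x \<in> L. algebraic_int x}"

definition pideal :: "complex set \<Rightarrow> complex \<Rightarrow> complex set" where
  "pideal R a = {a * x | x. x \<in> R}"

definition prime_ideal_in :: "complex set \<Rightarrow> complex set \<Rightarrow> bool" where
  "prime_ideal_in R I \<longleftrightarrow> I \<subseteq> R \<and> 0 \<in> I \<and> 1 \<notin> I \<and>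
     (\<forall>x\<in>I. \<forall>y\<in>I. x + y \<in> I) \<and> (\<forall>r\<in>R. \<forall>x\<in>I. r * x \<in> I) \<and>
     (\<forall>x\<in>R. \<forall>y\<in>R. x * y \<in> I \<longrightarrow> x \<in> I \<or> y \<in> I)"

definition int_adjoin :: "complex \<Rightarrow> complex set" where
  "int_adjoin a = {poly (map_poly of_int P) a | P :: int poly. True}"

definition ring_adjoin :: "complex set \<Rightarrow> complex \<Rightarrow> complex set" where
  "ring_adjoin R q = {poly P q | P. \<forall>i. coeff P i \<in> R}"

end

theory Submission
  imports Defs "Jordan_Normal_Form.Char_Poly"
begin

text \<open>
  Let \<open>\<tau>\<close> be the nontrivial automorphism of \<open>L/F\<close> and let \<open>q\<^sup>2 = p \<cdot> unit\<close> in \<open>L\<close>. Then \<open>u = \<tau> q / q\<close> is a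
  unit with all conjugates on the unit circle, hence a root of unity, and \<open>u \<equiv> 1\<close> modulo \<open>q\<close>
  because \<open>q + \<tau> q\<close> lies in the prime below \<open>q\<close>; so \<open>u\<close> has 2-power order. The case \<open>u = 1\<close> would make
  \<open>p\<close> a square up to units of \<open>F\<close>; if \<open>u\<close> has order at least 4 then \<open>\<i> \<in> L\<close> and \<open>L = K\<close>; and if
  \<open>u = -1\<close> then \<open>q\<^sup>2 = - p \<epsilon>\<close> with \<open>\<epsilon>\<close> a totally positive unit of \<open>F\<close>, which is a square by a theorem of
  Weber, so \<open>L = F(\<surd>(-p))\<close>. In all cases \<open>1 - u\<close> divides 2, so the index of \<open>\<O>[q]\<close> in the integers
  of \<open>L\<close> is a power of the prime above 2, at which \<open>\<O>[q]\<close> is maximal as \<open>q\<close> is a uniformiser.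

  Weber's theorem is proved without the unit theorem. The operator \<open>1 + \<sigma>\<close>, with \<open>\<sigma>\<close> a generator of
  the cyclic 2-group \<open>Gal(F/\<rat>)\<close>, is nilpotent on units modulo squares, so it suffices to treat \<open>\<epsilon>\<close> for
  which \<open>\<sigma> \<epsilon> / \<epsilon>\<close> is a square \<open>h\<^sup>2\<close>. The norm of \<open>h\<close> is \<open>1\<close> or \<open>-1\<close>; in the first case Hilbert 90
  gives a rational \<open>r\<close> with \<open>\<epsilon> \<in> r F\<^sup>2\<close>, and only \<open>2\<close>, a square in \<open>F\<close>, can divide \<open>r\<close> to an odd power; in
  the second case the same argument applied to \<open>p \<epsilon>\<close> contradicts the parity of the valuation at \<open>p\<close>.
\<close>

section \<open>Algebraic integers form a ring\<close>

text \<open>The characteristic polynomial of an integer matrix is monic with integer coefficients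
  and vanishes at every eigenvalue.\<close>

lemma algebraic_int_if_eigenvalue:
  fixes x :: complex and v :: "nat \<Rightarrow> complex" and a :: "nat \<Rightarrow> nat \<Rightarrow> int"
  assumes eq: "\<And>i. i < N \<Longrightarrow> x * v i = (\<Sum>j<N. of_int (a i j) * v j)"
    and nz: "i0 < N" "v i0 \<noteq> 0"
  shows "algebraic_int x"
proof -
  define A :: "int mat" where "A = mat N N (\<lambda>(i,j). a i j)"
  have A: "A \<in> carrier_mat N N" by (simp add: A_def)
  let ?B = "map_mat of_int A :: complex mat"
  have B: "?B \<in> carrier_mat N N" using A by simp
  have "eigenvector ?B (vec N v) x"
    unfolding eigenvector_def
  proof (intro conjI)
    show "vec N v \<in> carrier_vec (dim_row ?B)" using A by simp
    show "vec N v \<noteq> 0\<^sub>v (dim_row ?B)"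
      using nz A by (metis carrier_matD(1) index_map_mat(2) index_vec index_zero_vec(1))
    show "?B *\<^sub>v vec N v = x \<cdot>\<^sub>v vec N v"
      by (rule eq_vecI) (auto simp: A_def scalar_prod_def eq lessThan_atLeast0)
  qed
  hence "eigenvalue ?B x" unfolding eigenvalue_def by blast
  hence "poly (char_poly ?B) x = 0"
    using eigenvalue_root_char_poly[OF B] by blast
  hence "poly (map_poly of_int (char_poly A)) x = 0"
    by (simp add: of_int_hom.char_poly_hom[OF A])
  moreover have "lead_coeff (char_poly A) = 1"
    using degree_monic_char_poly[OF A] by auto
  ultimately show ?thesis
    unfolding algebraic_int_altdef_ipoly by blast
qed

definition int_span :: "complex set \<Rightarrow> complex set" where
  "int_span V = {\<Sum>w\<in>V. of_int (a w) * w | a :: complex \<Rightarrow> int. True}"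

lemma int_span_base: "finite V \<Longrightarrow> w \<in> V \<Longrightarrow> w \<in> int_span V"
  unfolding int_span_def
  by (rule CollectI, rule exI[of _ "\<lambda>z. if z = w then 1 else 0"])
     (simp add: if_distrib[of of_int] if_distrib[of "\<lambda>x. x * _"] cong: if_cong)

lemma int_span_zero: "0 \<in> int_span V"
  unfolding int_span_def by (rule CollectI, rule exI[of _ "\<lambda>_. 0"]) simp

lemma int_span_add: "x \<in> int_span V \<Longrightarrow> y \<in> int_span V \<Longrightarrow> x + y \<in> int_span V"
  unfolding int_span_def
  by clarify (rule_tac x = "\<lambda>z. a z + aa z" in exI, simp add: sum.distrib algebra_simps)

lemma int_span_mult_int: "x \<in> int_span V \<Longrightarrow> of_int k * x \<in> int_span V"
  unfolding int_span_def
  by clarify (rule_tac x = "\<lambda>z. k * a z" in exI, simp add: sum_distrib_left mult.assoc)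

lemma int_span_sum:
  "(\<And>i. i \<in> I \<Longrightarrow> f i \<in> int_span V) \<Longrightarrow> sum f I \<in> int_span V"
  by (induction I rule: infinite_finite_induct) (auto simp: int_span_zero int_span_add)

lemma int_span_mult_closed:
  assumes "\<And>w. w \<in> V \<Longrightarrow> x * w \<in> int_span V" and "y \<in> int_span V"
  shows "x * y \<in> int_span V"
proof -
  from assms(2) obtain a :: "complex \<Rightarrow> int" where y: "y = (\<Sum>w\<in>V. of_int (a w) * w)"
    unfolding int_span_def by blast
  have "x * y = (\<Sum>w\<in>V. of_int (a w) * (x * w))"
    by (simp add: y sum_distrib_left mult_ac)
  thus ?thesis using assms(1) by (auto intro!: int_span_sum int_span_mult_int)
qed

text \<open>An enumeration of \<open>V\<close> turns multiplication by \<open>x\<close> into an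
  integer matrix having the list of elements of \<open>V\<close> as an eigenvector;
  \<open>w0\<close> keeps this vector from being zero.\<close>

lemma algebraic_int_if_int_span_invariant:
  assumes fin: "finite V" and nz: "w0 \<in> V" "w0 \<noteq> 0"
    and inv: "\<And>w. w \<in> V \<Longrightarrow> x * w \<in> int_span V"
  shows "algebraic_int x"
proof -
  from fin obtain v where v: "bij_betw v {..<card V} V"
    using bij_betw_from_nat_into_finite by blast
  have "\<forall>w\<in>V. \<exists>a :: complex \<Rightarrow> int. x * w = (\<Sum>z\<in>V. of_int (a z) * z)"
    using inv unfolding int_span_def by blast
  then obtain a :: "complex \<Rightarrow> complex \<Rightarrow> int"
    where a: "\<And>w. w \<in> V \<Longrightarrow> x * w = (\<Sum>z\<in>V. of_int (a w z) * z)" by metis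
  from nz(1) v obtain i0 where i0: "i0 < card V" "v i0 = w0"
    by (metis bij_betw_iff_bijections lessThan_iff)
  show ?thesis
  proof (rule algebraic_int_if_eigenvalue[of "card V" x v "\<lambda>i j. a (v i) (v j)" i0])
    fix i assume "i < card V"
    hence "v i \<in> V" using v by (auto simp: bij_betw_def)
    from a[OF this] show "x * v i = (\<Sum>j<card V. of_int (a (v i) (v j)) * v j)"
      using sum.reindex_bij_betw[OF v, of "\<lambda>z. of_int (a (v i) z) * z"] by simp
  qed (use i0 nz in auto)
qed

lemma algebraic_int_power_reduction:
  fixes x :: complex
  assumes "algebraic_int x"
  obtains d and b :: "nat \<Rightarrow> int" where "d > 0" "x ^ d = (\<Sum>i<d. of_int (b i) * x ^ i)"
proof -
  from assms obtain f :: "int poly"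
    where f: "poly (map_poly of_int f) x = 0" "lead_coeff f = 1"
    unfolding algebraic_int_altdef_ipoly by blast
  have deg: "degree f > 0"
  proof (rule ccontr)
    assume "\<not> degree f > 0"
    hence "f = [:1:]" using f(2) by (metis degree_eq_zeroE gr0I lead_coeff_pCons(2) pCons_0_0)
    thus False using f(1) by simp
  qed
  have "0 = (\<Sum>i\<le>degree f. of_int (coeff f i) * x ^ i)"
    using f(1) by (simp add: poly_altdef)
  also have "{..degree f} = insert (degree f) {..<degree f}" by auto
  finally have "0 = x ^ degree f + (\<Sum>i<degree f. of_int (coeff f i) * x ^ i)"
    using f(2) by simp
  hence "x ^ degree f = (\<Sum>i<degree f. of_int (- coeff f i) * x ^ i)"
    by (simp add: sum_negf eq_neg_iff_add_eq_0)
  with deg show ?thesis by (rule that)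
qed

text \<open>The \<open>\<int>\<close>-module spanned by the monomials \<open>x\<^sup>i y\<^sup>j\<close> is stable under both \<open>x\<close> and \<open>y\<close>.\<close>

lemma algebraic_int_common_module:
  fixes x y :: complex
  assumes "algebraic_int x" "algebraic_int y"
  obtains V where "finite V" "1 \<in> V"
    "\<And>w. w \<in> V \<Longrightarrow> x * w \<in> int_span V" "\<And>w. w \<in> V \<Longrightarrow> y * w \<in> int_span V"
proof -
  obtain d b where d: "d > 0" "x ^ d = (\<Sum>i<d. of_int (b i) * x ^ i)"
    using algebraic_int_power_reduction[OF assms(1)] .
  obtain e c where e: "e > 0" "y ^ e = (\<Sum>i<e. of_int (c i) * y ^ i)"
    using algebraic_int_power_reduction[OF assms(2)] .
  define V where "V = (\<lambda>(i,j). x ^ i * y ^ j) ` ({..<d} \<times> {..<e})"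
  have fin: "finite V" by (simp add: V_def)
  have VI: "x ^ i * y ^ j \<in> int_span V" if "i < d" "j < e" for i j
    by (rule int_span_base[OF fin]) (use that in \<open>auto simp: V_def\<close>)
  show ?thesis
  proof (rule that[OF fin])
    show "1 \<in> V" unfolding V_def by (rule image_eqI[of _ _ "(0,0)"]) (use d e in auto)
  next
    fix w assume "w \<in> V"
    then obtain i j where w: "w = x ^ i * y ^ j" "i < d" "j < e" by (auto simp: V_def)
    show "x * w \<in> int_span V"
    proof (cases "Suc i < d")
      case True
      have "x * w = x ^ Suc i * y ^ j" by (simp add: w)
      thus ?thesis using VI[OF True w(3)] by (simp only:)
    next
      case False
      hence "Suc i = d" using w by simp
      hence "x * w = x ^ d * y ^ j" by (auto simp: w)
      also have "\<dots> = (\<Sum>i<d. of_int (b i) * (x ^ i * y ^ j))"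
        by (simp add: d(2) sum_distrib_right mult.assoc)
      also have "\<dots> \<in> int_span V" using w by (auto intro!: int_span_sum int_span_mult_int VI)
      finally show ?thesis .
    qed
    show "y * w \<in> int_span V"
    proof (cases "Suc j < e")
      case True
      have "y * w = x ^ i * y ^ Suc j" by (simp add: w)
      thus ?thesis using VI[OF w(2) True] by (simp only:)
    next
      case False
      hence "Suc j = e" using w by simp
      hence "y * w = x ^ i * y ^ e" by (auto simp: w)
      also have "\<dots> = (\<Sum>j<e. of_int (c j) * (x ^ i * y ^ j))"
        by (simp add: e(2) sum_distrib_left mult_ac)
      also have "\<dots> \<in> int_span V" using w by (auto intro!: int_span_sum int_span_mult_int VI)
      finally show ?thesis .
    qed
  qed
qed

lemma algebraic_int_add [intro]:
  fixes x y :: complex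
  assumes "algebraic_int x" "algebraic_int y"
  shows "algebraic_int (x + y)"
proof -
  obtain V where V: "finite V" "1 \<in> V" "\<And>w. w \<in> V \<Longrightarrow> x * w \<in> int_span V"
    "\<And>w. w \<in> V \<Longrightarrow> y * w \<in> int_span V"
    using algebraic_int_common_module[OF assms] by metis
  show ?thesis
    by (rule algebraic_int_if_int_span_invariant[OF V(1,2)])
       (use V in \<open>auto simp: distrib_right intro: int_span_add\<close>)
qed

lemma algebraic_int_mult [intro]:
  fixes x y :: complex
  assumes "algebraic_int x" "algebraic_int y"
  shows "algebraic_int (x * y)"
proof -
  obtain V where V: "finite V" "1 \<in> V" "\<And>w. w \<in> V \<Longrightarrow> x * w \<in> int_span V"
    "\<And>w. w \<in> V \<Longrightarrow> y * w \<in> int_span V"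
    using algebraic_int_common_module[OF assms] by metis
  show ?thesis
    by (rule algebraic_int_if_int_span_invariant[OF V(1,2)])
       (use V int_span_mult_closed[of V x] in \<open>auto simp: mult.assoc\<close>)
qed

lemma algebraic_int_diff [intro]:
  "algebraic_int (x::complex) \<Longrightarrow> algebraic_int y \<Longrightarrow> algebraic_int (x - y)"
  using algebraic_int_add[of x "- y"] by simp

lemma algebraic_int_pow [intro]: "algebraic_int (x::complex) \<Longrightarrow> algebraic_int (x ^ k)"
  by (induction k) auto

lemma algebraic_int_sum [intro]:
  "(\<And>i. i \<in> I \<Longrightarrow> algebraic_int (f i :: complex)) \<Longrightarrow> algebraic_int (sum f I)"
  by (induction I rule: infinite_finite_induct) auto

lemma algebraic_int_poly:
  "(\<And>i. algebraic_int (coeff P i)) \<Longrightarrow> algebraic_int (x::complex) \<Longrightarrow> algebraic_int (poly P x)"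
  unfolding poly_altdef by auto

lemma algebraic_int_numeral' [simp, intro]: "algebraic_int (numeral k :: complex)"
  by (intro int_imp_algebraic_int) simp

lemma algebraic_int_of_int' [simp, intro]: "algebraic_int (of_int k :: complex)"
  by (intro int_imp_algebraic_int) simp

lemma algebraic_int_of_nat' [simp, intro]: "algebraic_int (of_nat k :: complex)"
  by (intro int_imp_algebraic_int) simp

lemma algebraic_int_of_power:
  fixes x :: complex
  assumes "algebraic_int (x ^ k)" "k > 0"
  shows "algebraic_int x"
  by (rule algebraic_int_root[OF assms(1), of "monom 1 k"])
     (use assms in \<open>auto simp: poly_monom degree_monom_eq\<close>)

section \<open>Units and evaluation of integer polynomials\<close>

definition alg_unit :: "complex \<Rightarrow> bool" where
  "alg_unit x \<longleftrightarrow> x \<noteq> 0 \<and> algebraic_int x \<and> algebraic_int (inverse x)"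

lemma alg_unit_mult: "alg_unit x \<Longrightarrow> alg_unit y \<Longrightarrow> alg_unit (x * y)"
  by (auto simp: alg_unit_def)

lemma alg_unit_inverse: "alg_unit x \<Longrightarrow> alg_unit (inverse x)"
  by (auto simp: alg_unit_def)

lemma alg_unit_divide: "alg_unit x \<Longrightarrow> alg_unit y \<Longrightarrow> alg_unit (x / y)"
  unfolding divide_inverse by (intro alg_unit_mult alg_unit_inverse)

lemma alg_unit_power: "alg_unit x \<Longrightarrow> alg_unit (x ^ k)"
  by (auto simp: alg_unit_def simp flip: power_inverse)

lemma alg_unit_minus: "alg_unit x \<Longrightarrow> alg_unit (- x)"
  by (auto simp: alg_unit_def)

lemma alg_unit_of_power: "alg_unit (x ^ k) \<Longrightarrow> k > 0 \<Longrightarrow> alg_unit x"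
  unfolding alg_unit_def
  by (auto simp flip: power_inverse dest: algebraic_int_of_power)

lemma alg_unit_algebraic_int: "alg_unit x \<Longrightarrow> algebraic_int x"
  by (simp add: alg_unit_def)

lemma alg_unit_nonzero: "alg_unit x \<Longrightarrow> x \<noteq> 0"
  by (simp add: alg_unit_def)

lemma alg_unit_one [simp]: "alg_unit 1"
  by (auto simp: alg_unit_def)

lemma not_algebraic_int_half: "\<not> algebraic_int (1 / 2 :: complex)"
proof
  assume "algebraic_int (1 / 2 :: complex)"
  moreover have "(1 / 2 :: complex) \<in> \<rat>" by auto
  ultimately have "(1 / 2 :: complex) \<in> \<int>" by (rule rational_algebraic_int_is_int)
  then obtain k where "(1 / 2 :: complex) = of_int k" by (elim Ints_cases)
  hence "(of_int (2 * k) :: complex) = of_int 1" by (simp add: field_simps)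
  hence "2 * k = 1" by (simp only: of_int_eq_iff)
  thus False by presburger
qed

text \<open>Since \<open>1 + z = 1 - z ^ Suc j\<close>, the quotient is a geometric sum in
  \<open>z\<close>.\<close>

lemma one_plus_div_one_minus_algebraic_int:
  fixes z :: complex
  assumes "z ^ j = -1" "j > 0"
  shows "algebraic_int ((1 + z) / (1 - z))"
proof -
  have z: "algebraic_int z"
    by (rule algebraic_int_of_power[OF _ assms(2)]) (use assms in simp)
  have "z \<noteq> 1" using assms by auto
  moreover have "1 + z = 1 - z ^ Suc j" using assms by simp
  hence "1 + z = (1 - z) * (\<Sum>i<Suc j. z ^ i)"
    by (simp only: one_diff_power_eq)
  ultimately have "(1 + z) / (1 - z) = (\<Sum>i<Suc j. z ^ i)"
    by (simp add: field_simps del: sum.lessThan_Suc)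
  thus ?thesis using z by (simp only:) blast
qed

text \<open>Total ramification of 2. Passing from \<open>z\<close> to \<open>z\<^sup>2\<close>
  replaces \<open>(1 - z)\<^sup>2\<close> by \<open>1 - z\<^sup>2\<close> at the cost of the unit
  \<open>(1 - z) / (1 + z)\<close>; at the bottom \<open>z = -1\<close> and
  \<open>1 - z = 2\<close>.\<close>

lemma one_minus_two_power_root:
  fixes z :: complex
  assumes "z ^ (2 ^ k) = -1"
  shows "alg_unit ((1 - z) ^ (2 ^ k) / 2)"
  using assms
proof (induction k arbitrary: z)
  case 0
  thus ?case by simp
next
  case (Suc k)
  have zn: "z \<noteq> 1" "z \<noteq> - 1" using Suc.prems by auto
  have w: "(z\<^sup>2) ^ (2 ^ k) = - 1" using Suc.prems by (simp flip: power_mult)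
  have "algebraic_int ((1 + z) / (1 - z))"
    by (rule one_plus_div_one_minus_algebraic_int[OF Suc.prems]) simp
  \<comment> \<open>At \<open>- z\<close> the same lemma supplies the inverse ratio; the exponent
    \<open>2 ^ Suc k\<close> is even, so the sign disappears.\<close>
  moreover have "algebraic_int ((1 + (- z)) / (1 - (- z)))"
    by (rule one_plus_div_one_minus_algebraic_int[of _ "2 ^ Suc k"]) (use Suc.prems in simp_all)
  ultimately have r: "alg_unit ((1 - z) / (1 + z))"
    using zn by (auto simp: alg_unit_def add_eq_0_iff)
  have "(1 - z)\<^sup>2 = (1 - z\<^sup>2) * ((1 - z) / (1 + z))"
    using zn by (simp add: add_eq_0_iff field_simps power2_eq_square)
  hence "(1 - z) ^ (2 ^ Suc k) / 2 = ((1 - z\<^sup>2) ^ (2 ^ k) / 2) * ((1 - z) / (1 + z)) ^ (2 ^ k)"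
    by (simp add: power_mult power_mult_distrib power_divide)
  thus ?case using alg_unit_mult[OF Suc.IH[OF w] alg_unit_power[OF r]] by (simp only:)
qed

abbreviation ipoly :: "int poly \<Rightarrow> complex \<Rightarrow> complex" where
  "ipoly f z \<equiv> poly (map_poly of_int f) z"

lemma ipoly_add: "ipoly (f + g) z = ipoly f z + ipoly g z"
  by (simp add: of_int_poly_hom.hom_add)

lemma ipoly_diff: "ipoly (f - g) z = ipoly f z - ipoly g z"
  by (simp add: of_int_poly_hom.hom_minus)

lemma ipoly_minus: "ipoly (- f) z = - ipoly f z"
  by (simp add: of_int_poly_hom.hom_uminus)

lemma ipoly_mult: "ipoly (f * g) z = ipoly f z * ipoly g z"
  by (simp add: of_int_poly_hom.hom_mult)

lemma ipoly_pCons: "ipoly (pCons a f) z = of_int a + z * ipoly f z"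
  by (simp add: of_int_hom.map_poly_pCons_hom)

lemma ipoly_smult: "ipoly (Polynomial.smult a f) z = of_int a * ipoly f z"
  by (simp add: of_int_hom.map_poly_hom_smult)

lemma ipoly_power: "ipoly (f ^ k) z = ipoly f z ^ k"
  by (induction k) (auto simp: ipoly_mult)

lemma ipoly_altdef: "ipoly f z = (\<Sum>i\<le>degree f. of_int (coeff f i) * z ^ i)"
  by (simp add: poly_altdef)

lemma ipoly_pcompose: "ipoly (pcompose f g) z = ipoly f (ipoly g z)"
  by (induction f) (auto simp: pcompose_pCons ipoly_add ipoly_mult ipoly_pCons)

lemmas ipoly_simps = ipoly_add ipoly_diff ipoly_minus ipoly_mult ipoly_pCons ipoly_smult
  ipoly_power ipoly_pcompose

lemma algebraic_int_ipoly: "algebraic_int z \<Longrightarrow> algebraic_int (ipoly f z)"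
  by (rule algebraic_int_poly) auto

text \<open>Chebyshev polynomials in the normalisation \<open>2 * T_k (X / 2)\<close>.\<close>

fun lucas_poly :: "nat \<Rightarrow> int poly" where
  "lucas_poly 0 = [:2:]"
| "lucas_poly (Suc 0) = [:0, 1:]"
| "lucas_poly (Suc (Suc k)) = [:0, 1:] * lucas_poly (Suc k) - lucas_poly k"

lemma ipoly_lucas_poly:
  "z \<noteq> 0 \<Longrightarrow> ipoly (lucas_poly k) (z + inverse z) = z ^ k + inverse z ^ k"
  by (induction k rule: lucas_poly.induct) (auto simp: ipoly_simps field_simps)

text \<open>The index starts at \<open>Suc k\<close> because \<open>lucas_poly 0\<close> is the
  constant 2, which is not monic.\<close>

lemma lucas_poly_monic:
  "degree (lucas_poly (Suc k)) = Suc k \<and> lead_coeff (lucas_poly (Suc k)) = 1"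
proof (induction k rule: less_induct)
  case (less k)
  show ?case
  proof (cases k)
    case 0
    thus ?thesis by simp
  next
    case (Suc j)
    have j: "degree (lucas_poly (Suc j)) = Suc j" "coeff (lucas_poly (Suc j)) (Suc j) = 1"
      using less.IH[of j] Suc by auto
    have d: "degree (lucas_poly j) \<le> j"
      using less.IH[of "j - 1"] Suc by (cases j) auto
    have eq: "lucas_poly (Suc k) = pCons 0 (lucas_poly (Suc j)) - lucas_poly j"
      using Suc by simp
    have "degree (pCons 0 (lucas_poly (Suc j))) = Suc (Suc j)"
      using j by (metis degree_pCons_eq degree_0 nat.distinct(1))
    hence "degree (lucas_poly (Suc k)) = Suc k"
      using d Suc unfolding eq by (simp add: degree_add_eq_left diff_conv_add_uminus del: add_uminus_conv_diff)
    moreover have "coeff (lucas_poly (Suc k)) (Suc k) = 1"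
      using j d Suc unfolding eq by (simp add: coeff_eq_0)
    ultimately show ?thesis by simp
  qed
qed

text \<open>Pseudo-division scales the dividend by a power of the leading coefficient of
  \<open>g\<close>, which is 1.\<close>

lemma int_poly_division_monic:
  fixes f g :: "int poly"
  assumes "lead_coeff g = 1" "degree g > 0"
  obtains k r where "f = g * k + r" "degree r < degree g"
proof -
  obtain k r where kr: "pseudo_divmod f g = (k, r)" by fastforce
  have "g \<noteq> 0" using assms by auto
  from pseudo_divmod[OF this kr] assms have "f = g * k + r" "r = 0 \<or> degree r < degree g"
    by auto
  thus ?thesis using assms(2) by (intro that[of k r]) auto
qed

section \<open>The totally ramified prime\<close>

lemma not_eight_dvd_one_plus_three_power: "\<not> (8::nat) dvd 1 + 3 ^ k"
proof -
  have "(3::nat) ^ k mod 8 = 1 \<or> (3::nat) ^ k mod 8 = 3"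
  proof (induction k)
    case (Suc k)
    have "(3::nat) ^ Suc k mod 8 = 3 * (3 ^ k mod 8) mod 8" by (simp add: mod_mult_right_eq)
    thus ?case using Suc by auto
  qed auto
  thus ?thesis by presburger
qed

lemma nine_power_mod: "(9::nat) ^ k mod 16 = (if even k then 1 else 9)"
proof (induction k)
  case (Suc k)
  have "(9::nat) ^ Suc k mod 16 = 9 * (9 ^ k mod 16) mod 16" by (simp add: mod_mult_right_eq)
  thus ?case using Suc by auto
qed auto

text \<open>For \<open>l = 4 * i\<close>, \<open>3 ^ l - 1 = (9 ^ i - 1) * (9 ^ i + 1)\<close> and
  the second factor contains 2 exactly once, so halving the exponent halves the modulus. With
  \<open>three_power_cong_one\<close> this says that 3 has order \<open>2 ^ (k + 1)\<close> modulo
  \<open>2 ^ (k + 3)\<close>.\<close>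

lemma two_power_dvd_three_power_minus_one:
  "(2::nat) ^ (k + 3) dvd 3 ^ l - 1 \<Longrightarrow> 2 ^ (k + 1) dvd l"
proof (induction k arbitrary: l)
  case 0
  have "even l"
  proof (rule ccontr)
    assume "odd l"
    then obtain j where "l = 2 * j + 1" by (elim oddE)
    hence l: "(3::nat) ^ l = 3 * 9 ^ j" by (simp add: power_mult)
    have "(9::nat) ^ j mod 16 = 1 \<or> (9::nat) ^ j mod 16 = 9" by (simp add: nine_power_mod)
    hence "\<not> 8 dvd 3 * (9::nat) ^ j - 1" by presburger
    thus False using 0 l by simp
  qed
  thus ?case by simp
next
  case (Suc k)
  have "(2::nat) ^ (k + 3) dvd 2 ^ (Suc k + 3)" by (rule le_imp_power_dvd) simp
  hence "2 ^ (k + 1) dvd l" using Suc by (blast intro: dvd_trans)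
  hence "even l" using dvd_trans[of 2 "2 ^ (k + 1)" l] by simp
  then obtain j where l: "l = 2 * j" by (elim evenE)
  have "(2::nat) ^ 4 dvd 2 ^ (Suc k + 3)" by (rule le_imp_power_dvd) simp
  hence "16 dvd (9::nat) ^ j - 1" using Suc.prems by (auto simp: l power_mult intro: dvd_trans)
  hence "(9::nat) ^ j mod 16 = 1"
    using nine_power_mod[of j] by (cases "even j") (simp, presburger)
  hence "even j" by (rule contrapos_pp) (simp add: nine_power_mod)
  then obtain i where j: "j = 2 * i" by (elim evenE)
  have "(9::nat) ^ i mod 16 = 1 \<or> (9::nat) ^ i mod 16 = 9" by (simp add: nine_power_mod)
  hence "\<exists>t. (9::nat) ^ i + 1 = 2 * t \<and> odd t" by presburger
  then obtain t where t: "(9::nat) ^ i + 1 = 2 * t" "odd t" by blast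
  have ge: "(9::nat) ^ i \<ge> 1" by simp
  have "(3::nat) ^ l = (9 ^ i)\<^sup>2" by (simp add: l j power_mult flip: power_mult_distrib power_even_eq)
  also have "\<dots> - 1 = (9 ^ i - 1) * (9 ^ i + 1)"
    using ge by (cases "(9::nat) ^ i") (auto simp: power2_eq_square)
  finally have "(3::nat) ^ l - 1 = (9 ^ i - 1) * (9 ^ i + 1)" .
  hence "(3::nat) ^ l - 1 = ((9 ^ i - 1) * t) * 2"
    unfolding t(1) by (simp only: mult_ac)
  moreover have "(2::nat) ^ (Suc k + 3) = 2 ^ (k + 3) * 2" by (simp add: power_add)
  ultimately have "2 ^ (k + 3) * 2 dvd ((9 ^ i - 1) * t) * (2::nat)"
    using Suc.prems by (simp only:)
  moreover have "b dvd a" if "b * 2 dvd a * 2" for a b :: nat using that by simp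
  ultimately have "2 ^ (k + 3) dvd (9 ^ i - 1) * t" by blast
  moreover have "coprime ((2::nat) ^ (k + 3)) t" using t by (simp add: coprime_left_2_iff_odd)
  ultimately have "2 ^ (k + 3) dvd (9::nat) ^ i - 1" by (simp add: coprime_dvd_mult_left_iff)
  hence "2 ^ (k + 3) dvd (3::nat) ^ j - 1" by (simp add: j power_mult)
  hence "2 ^ (k + 1) dvd j" by (rule Suc.IH)
  thus ?case by (simp add: l)
qed

lemma three_power_cong_one: "(2::nat) ^ (k + 3) dvd 3 ^ (2 ^ (k + 1)) - 1"
proof (induction k)
  case (Suc k)
  define x where "x = (3::nat) ^ (2 ^ (k + 1))"
  have x: "x \<ge> 1" "odd x" by (auto simp: x_def)
  have "(3::nat) ^ (2 ^ (Suc k + 1)) = x * x" by (simp add: x_def flip: power_mult power_add)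
  moreover have "x * x - 1 = (x - 1) * (x + 1)" using x by (cases x) auto
  moreover have "2 dvd x + 1" using x by simp
  ultimately have "2 ^ (k + 3) * 2 dvd (3::nat) ^ (2 ^ (Suc k + 1)) - 1"
    using mult_dvd_mono[OF Suc.IH[folded x_def], of 2 "x + 1"] by (simp only:)
  moreover have "(2::nat) ^ (Suc k + 3) = 2 ^ (k + 3) * 2" by (simp add: power_add)
  ultimately show ?case by (simp only:)
qed auto

section \<open>The root of unity, its traces, and the generator of the prime above 2\<close>

locale two_power_cyclotomic =
  fixes s :: nat and \<zeta> :: complex
  assumes s_ge: "s \<ge> 3" and zeta_root: "\<zeta> ^ (2 ^ (s - 1)) = -1"
begin

text \<open>The degree of \<open>F\<close> over the rationals; the order of \<zeta> is
  \<open>4 * m\<close>.\<close>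

definition m :: nat where "m = 2 ^ (s - 2)"

lemma m_eq: obtains k where "s = k + 3" "m = 2 ^ (k + 1)" "2 * m = 2 ^ (s - 1)"
proof -
  obtain k where "s = k + 3" using s_ge by (metis add.commute le_Suc_ex)
  moreover from this have "m = 2 ^ (k + 1)" "2 * m = 2 ^ (s - 1)" unfolding m_def by auto
  ultimately show ?thesis by (rule that)
qed

lemma even_m: "even m" by (rule m_eq) simp

lemma m_pos: "m > 0" by (simp add: m_def)

lemma two_power_s: "2 ^ s = 4 * m"
proof -
  obtain k where "s = k + 3" using s_ge by (metis add.commute le_Suc_ex)
  thus ?thesis unfolding m_def by (simp add: power_add)
qed

lemma zeta_2m: "\<zeta> ^ (2 * m) = -1"
  by (rule m_eq) (use zeta_root in simp)

lemma zeta_4m: "\<zeta> ^ (4 * m) = 1"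
proof -
  have "\<zeta> ^ (4 * m) = (\<zeta> ^ (2 * m)) ^ 2" by (simp flip: power_mult)
  thus ?thesis by (simp add: zeta_2m)
qed

lemma zeta_nz [simp]: "\<zeta> \<noteq> 0"
  using zeta_2m m_pos by (metis mult_pos_pos neg_equal_0_iff_equal one_neq_zero pos2 zero_power)

lemma norm_zeta: "norm \<zeta> = 1"
  using power_eq_1_iff[OF zeta_4m] m_pos by simp

lemma cnj_zeta: "cnj \<zeta> = inverse \<zeta>"
  using norm_zeta complex_norm_square[of \<zeta>] by (simp add: field_simps inverse_unique)

text \<open>By Bezout the exponent \<open>gcd k (4 * m)\<close> also gives 1. It is a power of 2; a
  proper divisor of \<open>2 ^ s\<close> would divide \<open>2 ^ (s - 1)\<close>, where the value is
  -1.\<close>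

lemma zeta_power_eq_1_iff: "\<zeta> ^ k = 1 \<longleftrightarrow> 4 * m dvd k"
proof
  assume k: "\<zeta> ^ k = 1"
  show "4 * m dvd k"
  proof (cases "k = 0")
    case False
    obtain x y where xy: "k * x = (4 * m) * y + gcd k (4 * m)"
      using bezout_nat[OF False] by blast
    have "\<zeta> ^ (k * x) = 1" by (simp add: power_mult k)
    moreover have "\<zeta> ^ (4 * m * y) = 1" by (simp only: power_mult[of _ "4 * m"] zeta_4m) simp
    ultimately have g: "\<zeta> ^ gcd k (4 * m) = 1" by (simp only: xy power_add) simp
    have "gcd k (4 * m) dvd 2 ^ s" by (simp add: two_power_s)
    then obtain i where i: "i \<le> s" "gcd k (4 * m) = 2 ^ i"
      using divides_primepow_nat[OF two_is_prime_nat] by blast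
    show ?thesis
    proof (cases "i = s")
      case True
      thus ?thesis using i two_power_s by (metis gcd_dvd1)
    next
      case False
      hence "gcd k (4 * m) dvd 2 ^ (s - 1)" unfolding i by (intro le_imp_power_dvd) (use i in auto)
      then obtain j where "2 ^ (s - 1) = gcd k (4 * m) * j" by (elim dvdE)
      hence "\<zeta> ^ (2 ^ (s - 1)) = 1" by (simp only: power_mult g) simp
      thus ?thesis using zeta_root by simp
    qed
  qed auto
next
  assume "4 * m dvd k"
  then obtain j where "k = 4 * m * j" by (elim dvdE)
  hence "\<zeta> ^ k = (\<zeta> ^ (4 * m)) ^ j" by (simp only: power_mult[of \<zeta> "4 * m"])
  thus "\<zeta> ^ k = 1" by (simp only: zeta_4m power_one)
qed

text \<open>The trace of \<open>\<zeta> ^ k\<close> from the cyclotomic field to its real subfield;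
  for odd \<open>k\<close> these are the conjugates of \<open>c\<close>.\<close>

definition e :: "nat \<Rightarrow> complex" where "e k = \<zeta> ^ k + inverse \<zeta> ^ k"

definition c :: complex where "c = e 1"

lemma e_Suc_0 [simp]: "e (Suc 0) = c" by (simp add: c_def)

definition p :: complex where "p = 2 + c"

lemma e_0 [simp]: "e 0 = 2" by (simp add: e_def)

lemma ipoly_lucas_e: "ipoly (lucas_poly k) (e a) = e (a * k)"
  using ipoly_lucas_poly[of "\<zeta> ^ a" k] by (simp add: e_def power_mult power_inverse)

lemma e_mult_e: "b \<le> a \<Longrightarrow> e a * e b = e (a + b) + e (a - b)"
proof -
  assume "b \<le> a"
  then obtain d where d: "a = b + d" by (metis le_Suc_ex)
  show ?thesis by (simp add: d e_def power_add power_inverse field_simps)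
qed

lemma e_real: "e k = of_real (Re (e k))"
proof -
  have "cnj (e k) = e k" by (simp add: e_def cnj_zeta)
  thus ?thesis by (metis Reals_cnj_iff of_real_Re)
qed

text \<open>The number \<open>\<zeta> ^ (a * m)\<close> squares to -1. Hence
  \<open>lucas_poly m\<close> vanishes at every \<open>e a\<close> with \<open>a\<close> odd, and it
  takes the place of the minimal polynomial of \<open>c\<close>.\<close>

lemma e_mult_m: "odd a \<Longrightarrow> e (a * m) = 0"
proof -
  assume a: "odd a"
  have "(\<zeta> ^ (a * m)) ^ 2 = (\<zeta> ^ (2 * m)) ^ a" by (simp flip: power_mult add: mult_ac)
  also have "\<dots> = -1" using a by (simp add: zeta_2m)
  finally have *: "(\<zeta> ^ (a * m)) ^ 2 = -1" .
  have "e (a * m) = ((\<zeta> ^ (a * m)) ^ 2 + 1) / \<zeta> ^ (a * m)"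
    by (simp add: e_def power_inverse field_simps power2_eq_square)
  thus ?thesis by (simp add: *)
qed

lemma e_eq_iff: "e a = e b \<longleftrightarrow> \<zeta> ^ a = \<zeta> ^ b \<or> \<zeta> ^ (a + b) = 1"
proof -
  have "e a - e b = (\<zeta> ^ a - \<zeta> ^ b) * (\<zeta> ^ (a + b) - 1) / \<zeta> ^ (a + b)"
    by (simp add: e_def power_inverse field_simps power_add)
  thus ?thesis by (metis divide_eq_0_iff eq_iff_diff_eq_0 mult_eq_0_iff power_not_zero zeta_nz)
qed

lemma algebraic_int_zeta [intro]: "algebraic_int \<zeta>" "algebraic_int (inverse \<zeta>)"
proof -
  show "algebraic_int \<zeta>" by (rule algebraic_int_of_power[of _ "4 * m"]) (use zeta_4m m_pos in auto)
  show "algebraic_int (inverse \<zeta>)"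
    by (rule algebraic_int_of_power[of _ "4 * m"]) (use zeta_4m m_pos in \<open>auto simp: power_inverse\<close>)
qed

lemma algebraic_int_e [intro]: "algebraic_int (e k)"
  unfolding e_def by (intro algebraic_int_add algebraic_int_pow algebraic_int_zeta)

lemma algebraic_int_p [intro]: "algebraic_int p"
  unfolding p_def c_def by blast

text \<open>As \<open>p = (1 + \<zeta>)\<^sup>2 / \<zeta>\<close>, this is
  \<open>one_minus_two_power_root\<close> at \<open>- \<zeta>\<close>, up to a root of
  unity.\<close>

lemma alg_unit_p_power: "alg_unit (p ^ m / 2)"
proof -
  have z: "alg_unit \<zeta>" by (auto simp: alg_unit_def)
  have p: "p = (1 - (- \<zeta>))\<^sup>2 / \<zeta>" by (simp add: p_def c_def e_def field_simps power2_eq_square)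
  have "(- \<zeta>) ^ (2 ^ (s - 1)) = - 1" using zeta_root s_ge by simp
  from one_minus_two_power_root[OF this] have "alg_unit ((1 - (- \<zeta>)) ^ (2 ^ (s - 1)) / 2)" .
  moreover have "p ^ m / 2 = (1 - (- \<zeta>)) ^ (2 ^ (s - 1)) / 2 / \<zeta> ^ m"
    by (rule m_eq) (simp add: p power_divide flip: power_mult)
  ultimately show ?thesis using alg_unit_divide[OF _ alg_unit_power[OF z]] by (simp only:)
qed

lemma p_nz [simp]: "p \<noteq> 0"
  using alg_unit_nonzero[OF alg_unit_p_power] m_pos by auto

lemma algebraic_int_2_div_p_power: "k \<le> m \<Longrightarrow> algebraic_int (2 / p ^ k)"
proof -
  assume k: "k \<le> m"
  have "algebraic_int (inverse (p ^ m / 2))" using alg_unit_p_power by (simp add: alg_unit_def)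
  hence "algebraic_int (inverse (p ^ m / 2) * p ^ (m - k))" by blast
  moreover have "inverse (p ^ m / 2) * p ^ (m - k) = 2 / p ^ k"
    using k by (simp add: field_simps flip: power_add)
  ultimately show ?thesis by simp
qed

lemma algebraic_int_2_div_p: "algebraic_int (2 / p)"
  using algebraic_int_2_div_p_power[of 1] m_pos by simp

lemma not_algebraic_int_inverse_p: "\<not> algebraic_int (1 / p)"
proof
  assume "algebraic_int (1 / p)"
  hence "algebraic_int ((1 / p) ^ m * (p ^ m / 2))"
    using alg_unit_algebraic_int[OF alg_unit_p_power] by blast
  moreover have "(1 / p) ^ m * (p ^ m / 2) = 1 / 2" by (simp add: power_divide)
  ultimately show False using not_algebraic_int_half by simp
qed

lemma even_if_p_dvd: "algebraic_int (of_int k / p) \<Longrightarrow> even k"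
proof (rule ccontr)
  assume k: "algebraic_int (of_int k / p)" and "odd k"
  then obtain j where j: "k = 2 * j + 1" by (elim oddE)
  have "algebraic_int (of_int k / p - of_int j * (2 / p))"
    using k algebraic_int_2_div_p by blast
  moreover have "of_int k / p - of_int j * (2 / p) = 1 / p" by (simp add: j field_simps)
  ultimately show False using not_algebraic_int_inverse_p by simp
qed

text \<open>An Eisenstein-type argument: \<open>p ^ Suc i\<close> divides 2, hence the whole sum,
  the terms below \<open>i\<close> (even by induction) and the terms above \<open>i\<close>. So
  \<open>p\<close> divides coefficient \<open>i\<close>, which is therefore even.\<close>

lemma coeffs_even_if_2_dvd:
  assumes deg: "degree g < m" and int: "algebraic_int (ipoly g p / 2)"
  shows "even (coeff g i)"
proof (induction i rule: less_induct)
  case (less i)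
  show ?case
  proof (cases "i \<le> degree g")
    case False
    thus ?thesis by (simp add: coeff_eq_0)
  next
    case True
    have im: "Suc i \<le> m" using True deg by simp
    have "algebraic_int (ipoly g p / 2 * (2 / p ^ Suc i))"
      using int algebraic_int_2_div_p_power[OF im] by blast
    hence tot: "algebraic_int (ipoly g p / p ^ Suc i)" by simp
    have split: "{..degree g} = insert i ({..degree g} - {i})" using True by auto
    have "ipoly g p = of_int (coeff g i) * p ^ i
        + (\<Sum>j\<in>{..degree g} - {i}. of_int (coeff g j) * p ^ j)"
      unfolding ipoly_altdef by (subst split) (rule sum.insert, auto)
    hence eq: "of_int (coeff g i) / p = ipoly g p / p ^ Suc i
        - (\<Sum>j\<in>{..degree g} - {i}. of_int (coeff g j) * p ^ j / p ^ Suc i)"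
      by (simp add: sum_divide_distrib[symmetric] field_simps)
    have "algebraic_int (of_int (coeff g j) * p ^ j / p ^ Suc i)" if j: "j \<in> {..degree g} - {i}" for j
    proof (cases "j < i")
      case True
      then obtain t where t: "coeff g j = 2 * t" using less.IH[OF True] by (elim evenE)
      have "algebraic_int (of_int t * p ^ j * (2 / p ^ Suc i))"
        using algebraic_int_2_div_p_power[OF im] by blast
      thus ?thesis by (simp add: t mult_ac)
    next
      case False
      hence "j = Suc i + (j - Suc i)" using j by auto
      hence "p ^ j = p ^ Suc i * p ^ (j - Suc i)" by (metis power_add)
      hence "of_int (coeff g j) * p ^ j / p ^ Suc i = of_int (coeff g j) * p ^ (j - Suc i)" by simp
      thus ?thesis by (simp only:) blast
    qed
    hence "algebraic_int (of_int (coeff g i) / p)" unfolding eq using tot by blast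
    thus ?thesis by (rule even_if_p_dvd)
  qed
qed

text \<open>Zero is divisible by every power of 2, so \<open>coeffs_even_if_2_dvd\<close> can be
  iterated without end. Thus \<open>p\<close> has degree at least \<open>m\<close> over the
  rationals.\<close>

lemma ipoly_p_eq_0:
  assumes "degree g < m" "ipoly g p = 0"
  shows "g = 0"
proof -
  have *: "2 ^ k dvd coeff g i" if "degree g < m" "ipoly g p = 0" for k i and g :: "int poly"
    using that
  proof (induction k arbitrary: g)
    case (Suc k)
    have ev: "even (coeff g j)" for j by (rule coeffs_even_if_2_dvd) (use Suc.prems in auto)
    hence "[:2:] dvd g" by (simp add: const_poly_dvd_iff)
    then obtain g' where g': "g = Polynomial.smult 2 g'" by (elim dvdE) simp
    have "2 ^ k dvd coeff g' i"
      by (rule Suc.IH) (use Suc.prems in \<open>auto simp: g' ipoly_smult\<close>)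
    thus ?case by (simp add: g')
  qed auto
  have "coeff g i = 0" for i
  proof (rule ccontr)
    assume nz: "coeff g i \<noteq> 0"
    have "2 ^ nat \<bar>coeff g i\<bar> dvd coeff g i" by (rule *[OF assms])
    hence "\<bar>2 ^ nat \<bar>coeff g i\<bar>\<bar> \<le> \<bar>coeff g i\<bar>" by (rule dvd_imp_le_int[OF nz])
    hence "2 ^ nat \<bar>coeff g i\<bar> \<le> \<bar>coeff g i\<bar>" by (simp only: power_abs abs_numeral)
    moreover have "int k < 2 ^ k" for k by simp
    hence "int (nat \<bar>coeff g i\<bar>) < 2 ^ nat \<bar>coeff g i\<bar>" .
    ultimately show False by linarith
  qed
  thus ?thesis by (simp add: poly_eq_iff)
qed

text \<open>The remainder modulo \<open>lucas_poly m\<close> serves all conjugates at once.\<close>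

lemma ipoly_c_reduce:
  obtains r where "degree r < m" "\<And>a. odd a \<Longrightarrow> ipoly f (e a) = ipoly r (e a)"
proof -
  have L: "degree (lucas_poly m) = m" "lead_coeff (lucas_poly m) = 1"
    using lucas_poly_monic[of "m - 1"] m_pos by auto
  obtain k r where "f = lucas_poly m * k + r" "degree r < m"
    using int_poly_division_monic[of "lucas_poly m" f] L m_pos by metis
  thus ?thesis by (intro that[of r]) (auto simp: ipoly_simps ipoly_lucas_e e_mult_m)
qed

lemma ipoly_c_shift: "ipoly f c = ipoly (pcompose f [:-2, 1:]) p"
  by (simp add: ipoly_pcompose ipoly_pCons p_def)

text \<open>This makes the conjugations \<open>sg a\<close> well defined. The remainder has degree
  below \<open>m\<close> and vanishes at \<open>c = p - 2\<close>, so after the shift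
  \<open>ipoly_p_eq_0\<close> applies.\<close>

lemma ipoly_c_eq_0:
  assumes "ipoly f c = 0" "odd a"
  shows "ipoly f (e a) = 0"
proof -
  obtain r where r: "degree r < m" "\<And>a. odd a \<Longrightarrow> ipoly f (e a) = ipoly r (e a)"
    using ipoly_c_reduce[of f] by blast
  have "pcompose r [:-2, 1:] = 0"
    by (rule ipoly_p_eq_0) (use r(1) r(2)[of 1] assms in \<open>simp_all flip: ipoly_c_shift\<close>)
  hence "r = 0" by (simp add: pcompose_eq_0_iff)
  thus ?thesis using r(2)[OF assms(2)] by simp
qed

end

section \<open>The real subfield and its conjugations\<close>

text \<open>After vanishing low-order coefficients are stripped off, the constant term is nonzero
  and the relation can be solved for \<open>inverse y\<close>.\<close>

lemma nonzero_root_inverse: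
  fixes g :: "int poly"
  assumes "g \<noteq> 0" "ipoly g y = 0" "y \<noteq> 0"
  obtains h :: "int poly" and k :: int where "k \<noteq> 0" "inverse y = ipoly h y / of_int k"
proof -
  have "\<exists>h k. k \<noteq> 0 \<and> inverse y = ipoly h y / of_int k"
    using assms
  proof (induction g)
    case (pCons a g)
    show ?case
    proof (cases "a = 0")
      case True
      thus ?thesis using pCons by (auto simp: ipoly_pCons)
    next
      case False
      have "inverse y = ipoly (- g) y / of_int a"
        using pCons.prems False by (simp add: ipoly_simps field_simps add_eq_0_iff)
      thus ?thesis using False by blast
    qed
  qed auto
  thus ?thesis using that by blast
qed

lemma subfield_ipoly:
  assumes "is_subfield E" "x \<in> E"
  shows "ipoly f x \<in> E"
proof -
  have nat: "of_nat k \<in> E" for k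
    using assms(1) by (induction k) (auto simp: is_subfield_def)
  have int: "of_int k \<in> E" for k
    using assms(1) nat by (cases k rule: int_cases2) (auto simp: is_subfield_def)
  show ?thesis using assms int
    by (induction f) (auto simp: is_subfield_def ipoly_pCons)
qed

lemma subfield_of_int: "is_subfield E \<Longrightarrow> of_int k \<in> E"
  using subfield_ipoly[of E 0 "[:k:]"] by (simp add: is_subfield_def ipoly_pCons)

context two_power_cyclotomic
begin

lemma algebraic_int_c [intro]: "algebraic_int c"
  unfolding c_def by blast

lemma c_real: "c \<in> \<real>"
  using e_real[of 1] by (metis Reals_of_real c_def)

text \<open>A concrete model of \<open>field_gen {c}\<close>. Rational integer denominators suffice
  because \<open>c\<close> is integral, and conjugations then act on numerators only.\<close>

definition F :: "complex set" where "F = {ipoly f c / of_int N | f N. N \<noteq> 0}"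

lemma F_I: "N \<noteq> 0 \<Longrightarrow> ipoly f c / of_int N \<in> F"
  by (auto simp: F_def)

lemma F_E:
  assumes "x \<in> F"
  obtains f N where "N \<noteq> 0" "x = ipoly f c / of_int N"
  using assms by (auto simp: F_def)

lemma ipoly_in_F: "ipoly f c \<in> F"
  using F_I[of 1 f] by simp

lemma of_int_in_F [simp]: "of_int k \<in> F"
  using ipoly_in_F[of "[:k:]"] by (simp add: ipoly_pCons)

lemma zero_in_F [simp]: "0 \<in> F" and one_in_F [simp]: "1 \<in> F"
  using of_int_in_F[of 0] of_int_in_F[of 1] by simp_all

lemma numeral_in_F [simp]: "numeral k \<in> F"
  using of_int_in_F[of "numeral k"] by simp

lemma F_add: "x \<in> F \<Longrightarrow> y \<in> F \<Longrightarrow> x + y \<in> F"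
proof (elim F_E)
  fix f N g M assume "N \<noteq> 0" "M \<noteq> 0" "x = ipoly f c / of_int N" "y = ipoly g c / of_int M"
  hence "x + y = ipoly (Polynomial.smult M f + Polynomial.smult N g) c / of_int (N * M)" "N * M \<noteq> 0"
    by (auto simp: ipoly_simps field_simps)
  thus ?thesis using F_I by (simp only:)
qed

lemma F_mult: "x \<in> F \<Longrightarrow> y \<in> F \<Longrightarrow> x * y \<in> F"
proof (elim F_E)
  fix f N g M assume "N \<noteq> 0" "M \<noteq> 0" "x = ipoly f c / of_int N" "y = ipoly g c / of_int M"
  hence "x * y = ipoly (f * g) c / of_int (N * M)" "N * M \<noteq> 0"
    by (auto simp: ipoly_simps)
  thus ?thesis using F_I by (simp only:)
qed

lemma F_minus: "x \<in> F \<Longrightarrow> - x \<in> F"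
  using F_mult[of "-1" x] of_int_in_F[of "-1"] by simp

lemma F_diff: "x \<in> F \<Longrightarrow> y \<in> F \<Longrightarrow> x - y \<in> F"
  using F_add[of x "- y"] F_minus by simp

lemma F_inverse: "x \<in> F \<Longrightarrow> inverse x \<in> F"
proof (cases "x = 0")
  case False
  assume "x \<in> F"
  then obtain f N where N: "N \<noteq> 0" and x: "x = ipoly f c / of_int N" by (elim F_E)
  define y where "y = ipoly f c"
  have y: "y \<noteq> 0" using False by (auto simp: x y_def)
  have "algebraic_int y" unfolding y_def by (intro algebraic_int_ipoly algebraic_int_c)
  then obtain g where "ipoly g y = 0" "lead_coeff g = 1"
    unfolding algebraic_int_altdef_ipoly by blast
  moreover from this have "g \<noteq> 0" by auto
  ultimately obtain h k where k: "k \<noteq> 0" "inverse y = ipoly h y / of_int k"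
    using nonzero_root_inverse y by metis
  hence "inverse y \<in> F" using F_I[of k "pcompose h f"] by (simp add: ipoly_pcompose y_def)
  hence "of_int N * inverse y \<in> F" by (intro F_mult) auto
  thus ?thesis by (simp add: x y_def field_simps)
qed auto

lemma F_divide: "x \<in> F \<Longrightarrow> y \<in> F \<Longrightarrow> x / y \<in> F"
  unfolding divide_inverse by (intro F_mult F_inverse)

lemma F_power: "x \<in> F \<Longrightarrow> x ^ k \<in> F"
  by (induction k) (auto intro: F_mult)

lemma F_sum: "(\<And>i. i \<in> I \<Longrightarrow> f i \<in> F) \<Longrightarrow> sum f I \<in> F"
  by (induction I rule: infinite_finite_induct) (auto intro: F_add)

lemma F_prod: "(\<And>i. i \<in> I \<Longrightarrow> f i \<in> F) \<Longrightarrow> prod f I \<in> F"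
  by (induction I rule: infinite_finite_induct) (auto intro: F_mult)

lemma ipoly_lucas_c: "ipoly (lucas_poly k) c = e k"
  using ipoly_lucas_e[of k 1] by simp

lemma e_in_F [simp]: "e k \<in> F"
  using ipoly_in_F[of "lucas_poly k"] by (simp add: ipoly_lucas_c)

lemma c_in_F [simp]: "c \<in> F"
  using e_in_F[of 1] by simp

lemma p_in_F [simp]: "p \<in> F"
  unfolding p_def by (intro F_add) auto

lemmas F_intros = F_add F_mult F_minus F_diff F_inverse F_divide F_power F_sum F_prod

lemma is_subfield_F: "is_subfield F"
  unfolding is_subfield_def by (auto intro: F_intros)

lemma F_subset_subfield:
  assumes "is_subfield E" "c \<in> E"
  shows "F \<subseteq> E"
proof
  fix x assume "x \<in> F"
  then obtain f N where N: "N \<noteq> 0" and x: "x = ipoly f c / of_int N" by (elim F_E)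
  have "ipoly f c \<in> E" "inverse (of_int N) \<in> E"
    using subfield_ipoly[OF assms] subfield_of_int[OF assms(1), of N] assms(1) N
    by (auto simp: is_subfield_def)
  thus "x \<in> E" using assms(1) by (auto simp: x is_subfield_def divide_inverse)
qed

lemma field_gen_c: "field_gen {c} = F"
proof
  show "field_gen {c} \<subseteq> F" unfolding field_gen_def using is_subfield_F by auto
  show "F \<subseteq> field_gen {c}" unfolding field_gen_def using F_subset_subfield by auto
qed

text \<open>For odd \<open>a\<close>, the automorphism \<open>\<zeta> + \<zeta>\<^sup>-\<^sup>1 \<mapsto> \<zeta>\<^sup>a + \<zeta>\<^sup>-\<^sup>a\<close> of \<open>F\<close>; meaningless outside \<open>F\<close>.\<close>

definition sg :: "nat \<Rightarrow> complex \<Rightarrow> complex" where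
  "sg a x = (THE y. \<exists>f N. N \<noteq> 0 \<and> x = ipoly f c / of_int N \<and> y = ipoly f (e a) / of_int N)"

lemma sg_eq:
  assumes "odd a" "N \<noteq> 0"
  shows "sg a (ipoly f c / of_int N) = ipoly f (e a) / of_int N"
  unfolding sg_def
proof (rule the_equality)
  fix y assume "\<exists>g M. M \<noteq> 0 \<and> ipoly f c / of_int N = ipoly g c / of_int M \<and> y = ipoly g (e a) / of_int M"
  then obtain g M where M: "M \<noteq> 0" "ipoly f c / of_int N = ipoly g c / of_int M"
    "y = ipoly g (e a) / of_int M" by blast
  have "ipoly (Polynomial.smult M f - Polynomial.smult N g) c = 0"
    using M(1,2) assms(2) by (simp add: ipoly_simps field_simps)
  from ipoly_c_eq_0[OF this assms(1)] show "y = ipoly f (e a) / of_int N"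
    using M(1) assms(2) by (simp add: M(3) ipoly_simps field_simps)
qed (use assms in blast)

lemma sg_ipoly: "odd a \<Longrightarrow> sg a (ipoly f c) = ipoly f (e a)"
  using sg_eq[of a 1 f] by simp

lemma sg_of_int [simp]: "odd a \<Longrightarrow> sg a (of_int k) = of_int k"
  using sg_ipoly[of a "[:k:]"] by (simp add: ipoly_pCons)

lemma sg_0 [simp]: "odd a \<Longrightarrow> sg a 0 = 0" and sg_1 [simp]: "odd a \<Longrightarrow> sg a 1 = 1"
  and sg_numeral [simp]: "odd a \<Longrightarrow> sg a (numeral w) = numeral w"
  using sg_of_int[of a 0] sg_of_int[of a 1] sg_of_int[of a "numeral w"] by simp_all

lemma sg_e: "odd a \<Longrightarrow> sg a (e k) = e (a * k)"
  using sg_ipoly[of a "lucas_poly k"] by (simp add: ipoly_lucas_e ipoly_lucas_c)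

lemma sg_c: "odd a \<Longrightarrow> sg a c = e a"
  using sg_e[of a 1] by simp

lemma sg_add:
  assumes "odd a" "x \<in> F" "y \<in> F"
  shows "sg a (x + y) = sg a x + sg a y"
proof -
  obtain f N where N: "N \<noteq> 0" and x: "x = ipoly f c / of_int N" using assms by (elim F_E)
  obtain g M where M: "M \<noteq> 0" and y: "y = ipoly g c / of_int M" using assms by (elim F_E)
  have "x + y = ipoly (Polynomial.smult M f + Polynomial.smult N g) c / of_int (N * M)" "N * M \<noteq> 0"
    using N M by (auto simp: x y ipoly_simps field_simps)
  hence "sg a (x + y) = ipoly (Polynomial.smult M f + Polynomial.smult N g) (e a) / of_int (N * M)"
    using sg_eq[OF assms(1)] by (simp only:)
  thus ?thesis using N M assms(1) by (simp add: x y sg_eq ipoly_simps field_simps)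
qed

lemma sg_mult:
  assumes "odd a" "x \<in> F" "y \<in> F"
  shows "sg a (x * y) = sg a x * sg a y"
proof -
  obtain f N where N: "N \<noteq> 0" and x: "x = ipoly f c / of_int N" using assms by (elim F_E)
  obtain g M where M: "M \<noteq> 0" and y: "y = ipoly g c / of_int M" using assms by (elim F_E)
  have "x * y = ipoly (f * g) c / of_int (N * M)" "N * M \<noteq> 0"
    using N M by (auto simp: x y ipoly_simps)
  hence "sg a (x * y) = ipoly (f * g) (e a) / of_int (N * M)"
    using sg_eq[OF assms(1)] by (simp only:)
  thus ?thesis using N M assms(1) by (simp add: x y sg_eq ipoly_simps)
qed

lemma sg_minus: "odd a \<Longrightarrow> x \<in> F \<Longrightarrow> sg a (- x) = - sg a x"
  using sg_mult[of a "-1" x] sg_of_int[of a "-1"] of_int_in_F[of "-1"] by simp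

lemma sg_nonzero: "odd a \<Longrightarrow> x \<in> F \<Longrightarrow> x \<noteq> 0 \<Longrightarrow> sg a x \<noteq> 0"
  using sg_mult[of a x "inverse x"] F_inverse by fastforce

lemma sg_inverse: "odd a \<Longrightarrow> x \<in> F \<Longrightarrow> sg a (inverse x) = inverse (sg a x)"
  using sg_mult[of a x "inverse x"] F_inverse
  by (cases "x = 0") (auto simp: inverse_unique)

lemma sg_divide: "odd a \<Longrightarrow> x \<in> F \<Longrightarrow> y \<in> F \<Longrightarrow> sg a (x / y) = sg a x / sg a y"
  by (simp add: divide_inverse sg_mult sg_inverse F_inverse)

lemma sg_power: "odd a \<Longrightarrow> x \<in> F \<Longrightarrow> sg a (x ^ k) = sg a x ^ k"
  by (induction k) (auto simp: sg_mult F_power)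

lemma sg_sum: "odd a \<Longrightarrow> (\<And>i. i \<in> I \<Longrightarrow> f i \<in> F) \<Longrightarrow> sg a (sum f I) = (\<Sum>i\<in>I. sg a (f i))"
  by (induction I rule: infinite_finite_induct) (auto simp: sg_add F_sum)

lemma sg_prod: "odd a \<Longrightarrow> (\<And>i. i \<in> I \<Longrightarrow> f i \<in> F) \<Longrightarrow> sg a (prod f I) = (\<Prod>i\<in>I. sg a (f i))"
  by (induction I rule: infinite_finite_induct) (auto simp: sg_mult F_prod)

lemma sg_in_F: "odd a \<Longrightarrow> x \<in> F \<Longrightarrow> sg a x \<in> F"
proof (elim F_E)
  fix f N assume a: "odd a" and N: "N \<noteq> 0" "x = ipoly f c / of_int N"
  have "sg a x = ipoly (pcompose f (lucas_poly a)) c / of_int N"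
    using a N by (simp add: sg_eq ipoly_pcompose ipoly_lucas_e ipoly_lucas_c)
  thus ?thesis using F_I[OF N(1)] by simp
qed

lemma sg_sg:
  assumes "odd a" "odd b" "x \<in> F"
  shows "sg a (sg b x) = sg (a * b) x"
proof -
  obtain f N where N: "N \<noteq> 0" and x: "x = ipoly f c / of_int N" using assms by (elim F_E)
  have "sg b x = ipoly (pcompose f (lucas_poly b)) c / of_int N"
    using assms N by (simp add: x sg_eq ipoly_pcompose ipoly_lucas_e ipoly_lucas_c)
  hence "sg a (sg b x) = ipoly (pcompose f (lucas_poly b)) (e a) / of_int N"
    using sg_eq[OF assms(1) N] by simp
  thus ?thesis using assms N by (simp add: x sg_eq ipoly_pcompose ipoly_lucas_e ipoly_lucas_c)
qed

lemma sg_one_id: "x \<in> F \<Longrightarrow> sg 1 x = x"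
  by (elim F_E) (simp add: sg_eq)

lemma sg_cong_e:
  assumes "odd a" "odd b" "e a = e b" "x \<in> F"
  shows "sg a x = sg b x"
  using assms by (elim F_E) (simp add: sg_eq)

lemma F_real: "x \<in> F \<Longrightarrow> x = of_real (Re x)"
proof (elim F_E)
  fix f N assume x: "x = ipoly f c / of_int N"
  have "ipoly f c \<in> \<real>"
    unfolding ipoly_altdef by (intro sum_in_Reals Reals_mult Reals_power) (auto simp: c_real)
  hence "x \<in> \<real>" by (simp add: x)
  thus ?thesis by simp
qed

lemma sg_real: "odd a \<Longrightarrow> x \<in> F \<Longrightarrow> sg a x = of_real (Re (sg a x))"
  by (rule F_real) (rule sg_in_F)

text \<open>\<open>x\<close> and \<open>sg a x\<close> are roots of the same integer
  polynomials.\<close>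

lemma algebraic_int_sg:
  assumes "odd a" "x \<in> F"
  shows "algebraic_int (sg a x) \<longleftrightarrow> algebraic_int x"
proof -
  have *: "sg a (ipoly f x) = ipoly f (sg a x) \<and> ipoly f x \<in> F" for f
    using assms by (induction f) (auto simp: ipoly_pCons sg_add sg_mult F_add F_mult)
  have "ipoly f (sg a x) = 0 \<longleftrightarrow> ipoly f x = 0" for f
    using *[of f] sg_nonzero[of a "ipoly f x"] assms by auto
  thus ?thesis unfolding algebraic_int_altdef_ipoly by simp
qed

lemma alg_unit_sg: "odd a \<Longrightarrow> x \<in> F \<Longrightarrow> alg_unit x \<Longrightarrow> alg_unit (sg a x)"
  using algebraic_int_sg[of a x] algebraic_int_sg[of a "inverse x"]
  by (simp add: alg_unit_def sg_nonzero sg_inverse F_inverse)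

definition Ou :: "complex set" where "Ou = int_adjoin c"

lemma Ou_iff: "x \<in> Ou \<longleftrightarrow> (\<exists>f. x = ipoly f c)"
  by (auto simp: Ou_def int_adjoin_def)

lemma Ou_in_F: "x \<in> Ou \<Longrightarrow> x \<in> F"
  by (auto simp: Ou_iff ipoly_in_F)

lemma Ou_algebraic_int: "x \<in> Ou \<Longrightarrow> algebraic_int x"
  by (auto simp: Ou_iff intro: algebraic_int_ipoly)

lemma Ou_ipoly_p:
  assumes "x \<in> Ou"
  obtains g where "degree g < m" "x = ipoly g p"
proof -
  from assms obtain f where f: "x = ipoly f c" by (auto simp: Ou_iff)
  obtain r where r: "degree r < m" "\<And>a. odd a \<Longrightarrow> ipoly f (e a) = ipoly r (e a)"
    using ipoly_c_reduce[of f] by blast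
  show ?thesis
    by (rule that[of "pcompose r [:-2, 1:]"]) (use r(1) r(2)[of 1] f in \<open>simp_all flip: ipoly_c_shift\<close>)
qed

lemma Ou_of_ipoly_p: "ipoly g p \<in> Ou"
proof -
  have "ipoly g p = ipoly (pcompose g [:2, 1:]) c" by (simp add: ipoly_pcompose ipoly_pCons p_def)
  thus ?thesis by (auto simp: Ou_iff)
qed

text \<open>Written in the powers of \<open>p\<close> below \<open>p ^ m\<close>, an element
  divisible by 2 has even coefficients. Hence \<open>Ou\<close> is maximal at 2.\<close>

lemma Ou_half:
  assumes "y \<in> Ou" "algebraic_int (y / 2)"
  shows "y / 2 \<in> Ou"
proof -
  obtain g where g: "degree g < m" "y = ipoly g p" using Ou_ipoly_p[OF assms(1)] by blast
  have "even (coeff g j)" for j by (rule coeffs_even_if_2_dvd) (use g assms in auto)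
  hence "[:2:] dvd g" by (simp add: const_poly_dvd_iff)
  then obtain g' where g': "g = Polynomial.smult 2 g'" by (elim dvdE) simp
  have "y / 2 = ipoly g' p" by (simp add: g g' ipoly_smult)
  thus ?thesis using Ou_of_ipoly_p by simp
qed

lemma Ou_two_power:
  assumes "2 ^ k * x \<in> Ou" "algebraic_int x"
  shows "x \<in> Ou"
  using assms(1)
proof (induction k)
  case (Suc k)
  have "2 ^ Suc k * x / 2 \<in> Ou"
    by (rule Ou_half[OF Suc.prems]) (use assms(2) in \<open>auto intro!: algebraic_int_mult algebraic_int_pow\<close>)
  thus ?case using Suc.IH by simp
qed simp

end

section \<open>Integral closure and bounded conjugates\<close>

context two_power_cyclotomic
begin

text \<open>Coordinates \<open>b\<close> in the basis \<open>1, e 1, ..., e (m - 1)\<close>, read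
  off at the conjugation sending \<open>c\<close> to \<open>e a\<close>.\<close>

definition rep :: "(nat \<Rightarrow> int) \<Rightarrow> nat \<Rightarrow> complex" where
  "rep b a = of_int (b 0) + (\<Sum>j=1..<m. of_int (b j) * e (a * j))"

lemma rep_add: "rep (\<lambda>j. b j + b' j) a = rep b a + rep b' a"
  by (simp add: rep_def sum.distrib algebra_simps)

lemma rep_scale: "rep (\<lambda>j. k * b j) a = of_int k * rep b a"
  by (simp add: rep_def sum_distrib_left algebra_simps)

text \<open>One integer vector has to serve all conjugates, so that sums over the conjugates can
  recover it.\<close>

definition representable :: "(nat \<Rightarrow> complex) \<Rightarrow> bool" where
  "representable \<phi> \<longleftrightarrow> (\<exists>b. \<forall>a. odd a \<longrightarrow> \<phi> a = rep b a)"

lemma representable_add: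
  "representable \<phi> \<Longrightarrow> representable \<psi> \<Longrightarrow> representable (\<lambda>a. \<phi> a + \<psi> a)"
  unfolding representable_def by (metis rep_add)

lemma representable_scale: "representable \<phi> \<Longrightarrow> representable (\<lambda>a. of_int k * \<phi> a)"
  unfolding representable_def by (metis rep_scale)

lemma representable_const: "representable (\<lambda>a. of_int k)"
  unfolding representable_def
  by (rule exI[of _ "\<lambda>j. if j = 0 then k else 0"]) (simp add: rep_def)

lemma representable_e: 
  assumes "j \<le> m"
  shows "representable (\<lambda>a. e (a * j))"
proof -
  consider "j = 0" | "j = m" | "j \<in> {1..<m}" using assms by force
  thus ?thesis
  proof cases
    case 1
    thus ?thesis using representable_const[of 2] by simp
  next
    case 2
    thus ?thesis using representable_const[of 0] e_mult_m by (simp add: representable_def)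
  next
    case 3
    have "e (a * j) = rep (\<lambda>i. if i = j then 1 else 0) a" for a
    proof -
      have "(\<Sum>i=1..<m. of_int (if i = j then 1 else 0) * e (a * i))
          = (\<Sum>i=1..<m. if i = j then e (a * j) else 0)"
        by (intro sum.cong) auto
      also have "\<dots> = e (a * j)" using 3 by (subst sum.delta) auto
      finally show ?thesis using 3 by (simp add: rep_def)
    qed
    thus ?thesis unfolding representable_def by blast
  qed
qed

lemma representable_sum:
  "(\<And>i. i \<in> I \<Longrightarrow> representable (f i)) \<Longrightarrow> representable (\<lambda>a. \<Sum>i\<in>I. f i a)"
  by (induction I rule: infinite_finite_induct)
     (use representable_const[of 0] in \<open>auto intro: representable_add\<close>)

text \<open>Multiplication sends \<open>e (a * j)\<close> to
  \<open>e (a * (j + 1)) + e (a * (j - 1))\<close>. The index never leaves the range from 0 to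
  \<open>m\<close>, whose ends contribute 2 and 0.\<close>

lemma representable_mult_e:
  assumes "representable \<phi>"
  shows "representable (\<lambda>a. e a * \<phi> a)"
proof -
  from assms obtain b where b: "\<And>a. odd a \<Longrightarrow> \<phi> a = rep b a" by (auto simp: representable_def)
  have eq: "e a * \<phi> a = of_int (b 0) * e (a * 1)
      + (\<Sum>j=1..<m. of_int (b j) * (e (a * (j + 1)) + e (a * (j - 1))))" if "odd a" for a
  proof -
    have "e a * e (a * j) = e (a * (j + 1)) + e (a * (j - 1))" if "j \<ge> 1" for j
      using e_mult_e[of a "a * j"] that by (simp add: algebra_simps)
    hence "(\<Sum>j=1..<m. e a * (of_int (b j) * e (a * j)))
        = (\<Sum>j=1..<m. of_int (b j) * (e (a * (j + 1)) + e (a * (j - 1))))"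
      by (intro sum.cong) (auto simp: mult.left_commute[of "e a"])
    thus ?thesis using that by (simp add: b rep_def distrib_left sum_distrib_left mult.commute)
  qed
  have "representable (\<lambda>a. of_int (b 0) * e (a * 1)
      + (\<Sum>j=1..<m. of_int (b j) * (e (a * (j + 1)) + e (a * (j - 1)))))"
    using m_pos by (intro representable_add representable_scale representable_e representable_sum) auto
  then obtain b' where "\<And>a. odd a \<Longrightarrow> of_int (b 0) * e (a * 1)
      + (\<Sum>j=1..<m. of_int (b j) * (e (a * (j + 1)) + e (a * (j - 1)))) = rep b' a"
    unfolding representable_def by blast
  hence "\<forall>a. odd a \<longrightarrow> e a * \<phi> a = rep b' a" using eq by simp
  thus ?thesis unfolding representable_def by blast
qed

lemma representable_ipoly: "representable (\<lambda>a. ipoly f (e a))"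
proof (induction f)
  case 0
  thus ?case using representable_const[of 0] by simp
next
  case (pCons k f)
  thus ?case unfolding ipoly_pCons
    by (intro representable_add representable_const representable_mult_e)
qed

text \<open>Geometric sums with ratio a nontrivial root of unity of order dividing
  \<open>2 * m\<close>. The numbers \<open>2 * i + 1\<close> run over the odd residues modulo
  \<open>4 * m\<close>, so each conjugation is counted twice.\<close>

lemma sum_e_odd:
  assumes "0 < j" "j < 2 * m"
  shows "(\<Sum>i<2 * m. e ((2 * i + 1) * j)) = 0"
proof -
  have *: "(\<Sum>i<2 * m. w ^ ((2 * i + 1) * j)) = 0" if "w ^ (4 * m) = 1" "w ^ (2 * j) \<noteq> 1" for w :: complex
  proof -
    have "(\<Sum>i<2 * m. w ^ ((2 * i + 1) * j)) = w ^ j * (\<Sum>i<2 * m. (w ^ (2 * j)) ^ i)"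
      unfolding sum_distrib_left
      by (intro sum.cong) (auto simp: algebra_simps simp flip: power_mult power_add)
    also have "(w ^ (2 * j)) ^ (2 * m) = (w ^ (4 * m)) ^ j" by (simp add: algebra_simps flip: power_mult)
    hence "(w ^ (2 * j)) ^ (2 * m) = 1" using that by simp
    hence "(1 - w ^ (2 * j)) * (\<Sum>i<2 * m. (w ^ (2 * j)) ^ i) = 0"
      by (simp add: one_diff_power_eq[symmetric])
    hence "(\<Sum>i<2 * m. (w ^ (2 * j)) ^ i) = 0" using that by simp
    finally show ?thesis by simp
  qed
  have nz: "\<zeta> ^ (2 * j) \<noteq> 1"
  proof
    assume "\<zeta> ^ (2 * j) = 1"
    hence "4 * m dvd 2 * j" by (simp only: zeta_power_eq_1_iff)
    hence "4 * m \<le> 2 * j" using assms by (intro dvd_imp_le) auto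
    thus False using assms by simp
  qed
  have "(\<Sum>i<2 * m. \<zeta> ^ ((2 * i + 1) * j)) = 0" using nz zeta_4m by (intro *)
  moreover have "(\<Sum>i<2 * m. inverse \<zeta> ^ ((2 * i + 1) * j)) = 0"
    using nz zeta_4m by (intro *) (simp_all only: power_inverse inverse_1 inverse_eq_1_iff not_False_eq_True)
  ultimately show ?thesis by (simp add: e_def sum.distrib)
qed

text \<open>By \<open>e_mult_e\<close> products become sums, of which only \<open>e 0 = 2\<close> on
  the diagonal survives: the basis is orthogonal for the trace form.\<close>

lemma sum_e_e_odd:
  assumes "j \<in> {1..<m}" "l \<in> {1..<m}"
  shows "(\<Sum>i<2 * m. e ((2 * i + 1) * j) * e ((2 * i + 1) * l)) = (if j = l then of_nat (4 * m) else 0)"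
proof -
  have *: "(\<Sum>i<2 * m. e ((2 * i + 1) * j) * e ((2 * i + 1) * l)) = (if j = l then of_nat (4 * m) else 0)"
    if "l \<le> j" "j \<in> {1..<m}" "l \<in> {1..<m}" for j l
  proof -
    have "e ((2 * i + 1) * j) * e ((2 * i + 1) * l)
        = e ((2 * i + 1) * (j + l)) + e ((2 * i + 1) * (j - l))" for i
      using e_mult_e[OF mult_le_mono2[OF that(1)]] by (simp only: distrib_left diff_mult_distrib2)
    hence "(\<Sum>i<2 * m. e ((2 * i + 1) * j) * e ((2 * i + 1) * l))
        = (\<Sum>i<2 * m. e ((2 * i + 1) * (j + l))) + (\<Sum>i<2 * m. e ((2 * i + 1) * (j - l)))"
      by (simp only: sum.distrib)
    also have "(\<Sum>i<2 * m. e ((2 * i + 1) * (j + l))) = 0" by (rule sum_e_odd) (use that in auto)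
    also have "(\<Sum>i<2 * m. e ((2 * i + 1) * (j - l))) = (if j = l then of_nat (4 * m) else 0)"
    proof (cases "j = l")
      case False
      thus ?thesis using that by (subst sum_e_odd) auto
    qed simp
    finally show ?thesis by simp
  qed
  show ?thesis
  proof (cases "l \<le> j")
    case False
    have "(\<Sum>i<2 * m. e ((2 * i + 1) * j) * e ((2 * i + 1) * l))
        = (\<Sum>i<2 * m. e ((2 * i + 1) * l) * e ((2 * i + 1) * j))" by (simp only: mult.commute)
    thus ?thesis using *[of j l] assms False by auto
  qed (use * assms in blast)
qed

lemma rep_coeff_0: "(\<Sum>i<2 * m. rep b (2 * i + 1)) = of_nat (2 * m) * of_int (b 0)"
proof -
  have "(\<Sum>i<2 * m. rep b (2 * i + 1)) = of_nat (2 * m) * of_int (b 0)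
      + (\<Sum>i<2 * m. \<Sum>j=1..<m. of_int (b j) * e ((2 * i + 1) * j))"
    by (simp only: rep_def sum.distrib) simp
  also have "(\<Sum>i<2 * m. \<Sum>j=1..<m. of_int (b j) * e ((2 * i + 1) * j))
      = (\<Sum>j=1..<m. of_int (b j) * (\<Sum>i<2 * m. e ((2 * i + 1) * j)))"
    by (subst sum.swap) (simp only: sum_distrib_left)
  also have "(\<Sum>i<2 * m. e ((2 * i + 1) * j)) = 0" if "j \<in> {1..<m}" for j
    by (rule sum_e_odd) (use that in auto)
  hence "(\<Sum>j=1..<m. of_int (b j) * (\<Sum>i<2 * m. e ((2 * i + 1) * j))) = 0"
    by (intro sum.neutral ballI) (simp only: mult_zero_right)
  finally show ?thesis by simp
qed

lemma rep_coeff: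
  assumes "l \<in> {1..<m}"
  shows "(\<Sum>i<2 * m. rep b (2 * i + 1) * e ((2 * i + 1) * l)) = of_nat (4 * m) * of_int (b l)"
proof -
  have "(\<Sum>i<2 * m. rep b (2 * i + 1) * e ((2 * i + 1) * l)) =
      of_int (b 0) * (\<Sum>i<2 * m. e ((2 * i + 1) * l))
      + (\<Sum>i<2 * m. \<Sum>j=1..<m. of_int (b j) * (e ((2 * i + 1) * j) * e ((2 * i + 1) * l)))"
    by (simp only: rep_def distrib_right sum.distrib sum_distrib_right sum_distrib_left mult.assoc)
  also have "(\<Sum>i<2 * m. e ((2 * i + 1) * l)) = 0" by (rule sum_e_odd) (use assms in auto)
  also have "(\<Sum>i<2 * m. \<Sum>j=1..<m. of_int (b j) * (e ((2 * i + 1) * j) * e ((2 * i + 1) * l)))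
      = (\<Sum>j=1..<m. of_int (b j) * (\<Sum>i<2 * m. e ((2 * i + 1) * j) * e ((2 * i + 1) * l)))"
    by (subst sum.swap) (simp only: sum_distrib_left)
  also have "\<dots> = (\<Sum>j=1..<m. if j = l then of_nat (4 * m) * of_int (b l) else 0)"
    by (intro sum.cong refl) (use assms in \<open>simp only: sum_e_e_odd, simp\<close>)
  also have "\<dots> = of_nat (4 * m) * of_int (b l)" using assms by (subst sum.delta) auto
  finally show ?thesis by simp
qed

lemma Ou_add: "x \<in> Ou \<Longrightarrow> y \<in> Ou \<Longrightarrow> x + y \<in> Ou"
  by (auto simp: Ou_iff simp flip: ipoly_add)

lemma Ou_mult: "x \<in> Ou \<Longrightarrow> y \<in> Ou \<Longrightarrow> x * y \<in> Ou"
  by (auto simp: Ou_iff simp flip: ipoly_mult)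

lemma Ou_of_int: "of_int k \<in> Ou"
  unfolding Ou_iff by (rule exI[of _ "[:k:]"]) (simp add: ipoly_pCons)

lemma Ou_e: "e k \<in> Ou"
  unfolding Ou_iff using ipoly_lucas_c by metis

lemma Ou_sum: "(\<And>i. i \<in> I \<Longrightarrow> f i \<in> Ou) \<Longrightarrow> sum f I \<in> Ou"
  by (induction I rule: infinite_finite_induct) (use Ou_of_int[of 0] in \<open>auto intro: Ou_add\<close>)

text \<open>By orthogonality the coordinates of \<open>4 * m * x\<close> are integral combinations
  of conjugates of \<open>x\<close> and of the basis, hence rational integers. As
  \<open>4 * m\<close> is a power of 2, maximality at 2 finishes.\<close>

theorem F_algebraic_int_in_Ou:
  assumes x: "x \<in> F" "algebraic_int x"
  shows "x \<in> Ou"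
proof -
  obtain f N where N: "N \<noteq> 0" and xf: "x = ipoly f c / of_int N" using x by (elim F_E)
  obtain b where b: "\<And>a. odd a \<Longrightarrow> ipoly f (e a) = rep b a"
    using representable_ipoly[of f] unfolding representable_def by blast
  have sgx: "rep b a / of_int N = sg a x" if "odd a" for a
    using that N by (simp add: xf sg_eq b)
  have int: "algebraic_int (rep b (2 * i + 1) / of_int N)" for i
    using algebraic_int_sg[of "2 * i + 1" x] x by (subst sgx) auto
  have ex: "\<exists>k. of_nat (4 * m) * of_int (b l) / (of_int N :: complex) = of_int k" if "l < m" for l
  proof -
    have "algebraic_int (of_nat (4 * m) * of_int (b l) / (of_int N :: complex))"
    proof (cases "l = 0")
      case True
      \<comment> \<open>\<open>rep_coeff_0\<close> carries the factor \<open>2 * m\<close>; doubling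
        brings it to the common \<open>4 * m\<close>.\<close>
      have "2 * (\<Sum>i<2 * m. rep b (2 * i + 1) / of_int N) = of_nat (4 * m) * of_int (b l) / (of_int N :: complex)"
        using True by (simp only: sum_divide_distrib[symmetric] rep_coeff_0) simp
      moreover have "algebraic_int (2 * (\<Sum>i<2 * m. rep b (2 * i + 1) / of_int N))"
        using int by blast
      ultimately show ?thesis by simp
    next
      case False
      hence l: "l \<in> {1..<m}" using that by auto
      have "(\<Sum>i<2 * m. rep b (2 * i + 1) / of_int N * e ((2 * i + 1) * l))
          = of_nat (4 * m) * of_int (b l) / (of_int N :: complex)"
        by (simp only: rep_coeff[OF l, symmetric] times_divide_eq_left sum_divide_distrib)
      moreover have "algebraic_int (\<Sum>i<2 * m. rep b (2 * i + 1) / of_int N * e ((2 * i + 1) * l))"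
        using int by blast
      ultimately show ?thesis by simp
    qed
    moreover have "of_nat (4 * m) * of_int (b l) / (of_int N :: complex) \<in> \<rat>" by auto
    ultimately have "of_nat (4 * m) * of_int (b l) / (of_int N :: complex) \<in> \<int>"
      by (rule rational_algebraic_int_is_int)
    thus ?thesis by (elim Ints_cases) blast
  qed
  then obtain k where k: "\<And>l. l < m \<Longrightarrow> of_nat (4 * m) * of_int (b l) / (of_int N :: complex) = of_int (k l)"
    by metis
  have "x = rep b 1 / of_int N" using sgx[of 1] x by (simp add: sg_one_id[unfolded One_nat_def])
  hence "of_nat (4 * m) * x = of_nat (4 * m) * of_int (b 0) / of_int N
      + (\<Sum>j=1..<m. of_nat (4 * m) * of_int (b j) / of_int N * e j)"
    by (simp add: rep_def sum_distrib_left sum_divide_distrib add_divide_distrib distrib_left mult_ac)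
  also have "\<dots> = of_int (k 0) + (\<Sum>j=1..<m. of_int (k j) * e j)"
    using m_pos by (intro arg_cong2[of _ _ _ _ "(+)"] sum.cong)
      (auto simp: k simp del: of_nat_mult times_divide_eq_left)
  also have "\<dots> \<in> Ou" by (intro Ou_add Ou_sum Ou_mult Ou_of_int Ou_e)
  finally have "2 ^ s * x \<in> Ou" by (metis two_power_s of_nat_numeral of_nat_power)
  thus ?thesis using x(2) by (rule Ou_two_power)
qed

text \<open>The orthogonality relations express each coordinate by conjugates of \<open>x\<close>
  and basis elements, all of absolute value at most 2; averaging bounds the coordinate by 2.\<close>

lemma finite_bounded_conjugates:
  "finite {x \<in> Ou. \<forall>a. odd a \<longrightarrow> norm (sg a x) \<le> 2}"
proof (rule finite_subset)
  show "finite ((\<lambda>b. rep b 1) ` (PiE {..<m} (\<lambda>_. {-2..2::int})))"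
    by (intro finite_imageI finite_PiE) auto
  show "{x \<in> Ou. \<forall>a. odd a \<longrightarrow> norm (sg a x) \<le> 2} \<subseteq> (\<lambda>b. rep b 1) ` (PiE {..<m} (\<lambda>_. {-2..2::int}))"
  proof clarify
    fix x assume x: "x \<in> Ou" and bd: "\<forall>a. odd a \<longrightarrow> norm (sg a x) \<le> 2"
    from x obtain f where xf: "x = ipoly f c" by (auto simp: Ou_iff)
    obtain b where b: "\<And>a. odd a \<Longrightarrow> ipoly f (e a) = rep b a"
      using representable_ipoly[of f] unfolding representable_def by blast
    have nb: "norm (rep b (2 * i + 1)) \<le> 2" for i
      using bd[rule_format, of "2 * i + 1"] b[of "2 * i + 1"] by (simp add: xf sg_ipoly)
    have bl: "b l \<in> {-2..2}" if "l < m" for l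
    proof (cases "l = 0")
      case True
      have "real (2 * m) * \<bar>real_of_int (b 0)\<bar> = norm (\<Sum>i<2 * m. rep b (2 * i + 1))"
        unfolding rep_coeff_0 by (simp add: norm_mult)
      also have "\<dots> \<le> (\<Sum>i<2 * m. 2)" by (intro sum_norm_le nb)
      finally have "\<bar>real_of_int (b 0)\<bar> \<le> 2" using m_pos by simp
      hence "\<bar>b 0\<bar> \<le> 2" by linarith
      thus ?thesis using True by auto
    next
      case False
      hence l: "l \<in> {1..<m}" using that by auto
      have ne: "norm (e k) \<le> 2" for k
        using norm_triangle_ineq[of "\<zeta> ^ k" "inverse \<zeta> ^ k"]
        by (simp add: e_def norm_power norm_inverse norm_zeta)
      have "real (4 * m) * \<bar>real_of_int (b l)\<bar> = norm (\<Sum>i<2 * m. rep b (2 * i + 1) * e ((2 * i + 1) * l))"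
        unfolding rep_coeff[OF l] by (simp add: norm_mult)
      also have "\<dots> \<le> (\<Sum>i<2 * m. 2 * 2)"
        unfolding norm_mult by (intro sum_norm_le) (simp only: norm_mult, intro mult_mono nb ne, auto)
      finally have "\<bar>real_of_int (b l)\<bar> \<le> 2" using m_pos by simp
      hence "\<bar>b l\<bar> \<le> 2" by linarith
      thus ?thesis by auto
    qed
    \<comment> \<open>Only coordinates below \<open>m\<close> enter \<open>rep\<close>; the
      restriction makes the vector a member of the finite \<open>PiE\<close>.\<close>
    have "x = rep (restrict b {..<m}) 1"
    proof -
      have "rep (restrict b {..<m}) 1 = rep b 1"
        unfolding rep_def using m_pos by (intro arg_cong2[of _ _ _ _ "(+)"] sum.cong) auto
      thus ?thesis using b[of 1] xf by simp
    qed
    moreover have "restrict b {..<m} \<in> PiE {..<m} (\<lambda>_. {-2..2})" using bl by auto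
    ultimately show "x \<in> (\<lambda>b. rep b 1) ` (PiE {..<m} (\<lambda>_. {-2..2::int}))" by blast
  qed
qed

text \<open>The residue is the parity of the constant coefficient in the expansion in
  \<open>p\<close>, since \<open>p\<close> divides 2.\<close>

lemma Ou_residue:
  assumes "x \<in> Ou"
  obtains "algebraic_int (x / p)" | "algebraic_int ((x - 1) / p)"
proof -
  obtain g where g: "x = ipoly g p" using Ou_ipoly_p[OF assms] by blast
  obtain k h where gk: "g = pCons k h" by (cases g)
  have x: "x / p = of_int k / p + ipoly h p" by (simp add: g gk ipoly_pCons field_simps)
  have h: "algebraic_int (ipoly h p)" by (rule algebraic_int_ipoly) auto
  obtain j where "k = 2 * j \<or> k = 2 * j + 1" by (metis oddE evenE)
  thus ?thesis
  proof
    assume k: "k = 2 * j"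
    have "x / p = of_int j * (2 / p) + ipoly h p" unfolding x by (simp add: k)
    also have "algebraic_int \<dots>" using h algebraic_int_2_div_p by blast
    finally show ?thesis using that by blast
  next
    assume k: "k = 2 * j + 1"
    have "(x - 1) / p = of_int j * (2 / p) + ipoly h p"
      unfolding diff_divide_distrib x by (simp add: k add_divide_distrib)
    also have "algebraic_int \<dots>" using h algebraic_int_2_div_p by blast
    finally show ?thesis using that by blast
  qed
qed

end

section \<open>Totally positive units\<close>

lemma algebraic_int_frobenius_add:
  fixes x y :: complex
  assumes "prime l" "algebraic_int x" "algebraic_int y"
  shows "algebraic_int (((x + y) ^ l - x ^ l - y ^ l) / of_nat l)"
proof -
  have l: "l > 1" using assms(1) by (rule prime_gt_1_nat)
  have "{..l} = insert 0 (insert l {1..<l})" using l by auto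
  hence "(x + y) ^ l = y ^ l + (x ^ l + (\<Sum>k=1..<l. of_nat (l choose k) * x ^ k * y ^ (l - k)))"
    using l by (simp add: binomial_ring)
  hence "((x + y) ^ l - x ^ l - y ^ l) / of_nat l
      = (\<Sum>k=1..<l. of_nat (l choose k) * x ^ k * y ^ (l - k) / of_nat l)"
    by (simp add: sum_divide_distrib)
  moreover have "algebraic_int (of_nat (l choose k) * x ^ k * y ^ (l - k) / of_nat l)" if "k \<in> {1..<l}" for k
  proof -
    have "l dvd l choose k" using that assms(1) by (intro dvd_choose_prime) auto
    then obtain t where "l choose k = l * t" by (elim dvdE)
    hence "of_nat (l choose k) * x ^ k * y ^ (l - k) / of_nat l = of_nat t * x ^ k * y ^ (l - k)"
      using l by simp
    thus ?thesis using assms(2,3) by (simp only:) blast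
  qed
  ultimately show ?thesis by (simp only:) (rule algebraic_int_sum)
qed

lemma algebraic_int_fermat:
  assumes "prime l"
  shows "algebraic_int ((of_int k ^ l - of_int k) / of_nat l :: complex)"
proof (induction k rule: int_induct[of _ 0])
  case base
  thus ?case using prime_gt_0_nat[OF assms] by (simp add: zero_power)
next
  case (step1 k)
  have "algebraic_int ((of_int k ^ l - of_int k) / of_nat l
      + ((of_int k + 1) ^ l - of_int k ^ l - 1 ^ l) / of_nat l :: complex)"
    using step1 algebraic_int_frobenius_add[OF assms, of "of_int k" 1] by blast
  thus ?case by (simp add: add_divide_distrib[symmetric] diff_diff_eq add.commute)
next
  case (step2 k)
  have "algebraic_int ((of_int k ^ l - of_int k) / of_nat l
      - ((of_int (k - 1) + 1) ^ l - of_int (k - 1) ^ l - 1 ^ l) / of_nat l :: complex)"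
    using step2 algebraic_int_frobenius_add[OF assms, of "of_int (k - 1)" 1] by blast
  thus ?case by (simp add: diff_divide_distrib[symmetric] algebra_simps)
qed

lemma algebraic_int_of_int_div: "algebraic_int (of_int a / of_int b :: complex) \<Longrightarrow> b \<noteq> 0 \<Longrightarrow> b dvd a"
proof -
  assume a: "algebraic_int (of_int a / of_int b :: complex)" and b: "b \<noteq> 0"
  have "(of_int a / of_int b :: complex) \<in> \<rat>" by auto
  with a have "(of_int a / of_int b :: complex) \<in> \<int>" by (rule rational_algebraic_int_is_int)
  then obtain k where "(of_int a / of_int b :: complex) = of_int k" by (elim Ints_cases)
  hence "(of_int a :: complex) = of_int (b * k)" using b by (simp add: field_simps)
  hence "a = b * k" by (simp only: of_int_eq_iff)
  thus ?thesis by simp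
qed

context two_power_cyclotomic
begin

section \<open>The valuation at \<open>p\<close>\<close>

definition p_odd :: "complex \<Rightarrow> bool" where
  "p_odd x \<longleftrightarrow> x \<in> Ou \<and> \<not> algebraic_int (x / p)"

lemma p_odd_mult:
  assumes "p_odd x" "p_odd y"
  shows "p_odd (x * y)"
proof -
  have x: "x \<in> Ou" "algebraic_int ((x - 1) / p)" and y: "y \<in> Ou" "algebraic_int ((y - 1) / p)"
    using assms Ou_residue[of x] Ou_residue[of y] by (auto simp: p_odd_def)
  have "\<not> algebraic_int (x * y / p)"
  proof
    assume "algebraic_int (x * y / p)"
    hence "algebraic_int (x * y / p - (x * ((y - 1) / p) + (x - 1) / p))"
      using x y Ou_algebraic_int by blast
    moreover have "x * y / p - (x * ((y - 1) / p) + (x - 1) / p) = 1 / p"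
      by (simp add: diff_divide_distrib right_diff_distrib)
    ultimately show False using not_algebraic_int_inverse_p by simp
  qed
  thus ?thesis using x y by (simp add: p_odd_def Ou_mult)
qed

lemma p_odd_one: "p_odd 1"
  using Ou_of_int[of 1] not_algebraic_int_inverse_p by (simp add: p_odd_def)

lemma p_odd_power: "p_odd x \<Longrightarrow> p_odd (x ^ k)"
  by (induction k) (auto intro: p_odd_mult p_odd_one)

lemma p_odd_unit: "alg_unit x \<Longrightarrow> x \<in> F \<Longrightarrow> p_odd x"
proof -
  assume x: "alg_unit x" "x \<in> F"
  have "\<not> algebraic_int (x / p)"
  proof
    assume "algebraic_int (x / p)"
    hence "algebraic_int (x / p * inverse x)" using x unfolding alg_unit_def by blast
    moreover have "x / p * inverse x = 1 / p" using alg_unit_nonzero[OF x(1)] by (simp add: field_simps)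
    ultimately show False using not_algebraic_int_inverse_p by simp
  qed
  thus ?thesis using x by (simp add: p_odd_def F_algebraic_int_in_Ou alg_unit_algebraic_int)
qed

lemma p_factor:
  assumes "y \<in> Ou" "y \<noteq> 0"
  obtains v y' where "p_odd y'" "y = p ^ v * y'"
proof -
  have "\<exists>k. \<not> algebraic_int (y / p ^ k)"
  proof (rule ccontr)
    assume "\<nexists>k. \<not> algebraic_int (y / p ^ k)"
    hence all: "algebraic_int (y / p ^ k)" for k by simp
    have "inverse y \<in> F" using assms Ou_in_F F_inverse by blast
    then obtain f N where N: "N \<noteq> 0" "inverse y = ipoly f c / of_int N" by (elim F_E)
    have iy: "of_int N * inverse y = ipoly f c" using N by (simp add: field_simps)
    \<comment> \<open>If all \<open>y / p ^ k\<close> were integral, so would be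
      \<open>N / 2 ^ j\<close>, because \<open>p ^ m\<close> is 2 up to a unit and
      \<open>N / y\<close> is integral. This choice makes \<open>2 ^ j\<close> too large to divide
      \<open>N\<close>.\<close>
    define j where "j = nat \<bar>N\<bar>"
    have "algebraic_int (y / p ^ (m * j) * (p ^ m / 2) ^ j * ipoly f c)"
      using all alg_unit_algebraic_int[OF alg_unit_p_power] algebraic_int_ipoly[OF algebraic_int_c] by blast
    also have "y / p ^ (m * j) * (p ^ m / 2) ^ j * ipoly f c = of_int N / of_int (2 ^ j)"
      unfolding iy[symmetric] using assms(2) by (simp add: power_divide field_simps flip: power_mult)
    finally have "2 ^ j dvd N" by (rule algebraic_int_of_int_div) simp
    hence "\<bar>2 ^ j\<bar> \<le> \<bar>N\<bar>" by (rule dvd_imp_le_int[OF N(1)])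
    moreover have "int k < 2 ^ k" for k by simp
    hence "int j < 2 ^ j" .
    ultimately show False by (simp add: j_def)
  qed
  then obtain k where k: "\<not> algebraic_int (y / p ^ k)" "\<And>i. i < k \<Longrightarrow> algebraic_int (y / p ^ i)"
    using exists_least_iff[of "\<lambda>k. \<not> algebraic_int (y / p ^ k)"] by blast
  have "k \<noteq> 0" using k(1) Ou_algebraic_int[OF assms(1)] by (intro notI) simp
  then obtain v where v: "k = Suc v" by (cases k) auto
  show ?thesis
  proof (rule that[of "y / p ^ v" v])
    have "y / p ^ v \<in> F" using assms Ou_in_F by (intro F_intros) auto
    thus "p_odd (y / p ^ v)"
      using k v F_algebraic_int_in_Ou[of "y / p ^ v"] by (simp add: p_odd_def mult.commute)
  qed simp
qed

lemma p_factor_unique: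
  assumes "p_odd a" "p_odd b" "p ^ i * a = p ^ j * b"
  shows "i = j"
proof -
  have *: False if "i < j" "p_odd a" "p_odd b" "p ^ i * a = p ^ j * b" for i j a b
  proof -
    from that(1) obtain d where d: "j = i + Suc d" using less_imp_Suc_add by auto
    have "a / p = p ^ d * b" using that(4) by (simp add: d power_add field_simps)
    moreover have "algebraic_int (p ^ d * b)" using that(3) Ou_algebraic_int by (auto simp: p_odd_def)
    ultimately show False using that(2) by (simp add: p_odd_def)
  qed
  show ?thesis using *[of i j a b] *[of j i b a] assms by (metis linorder_neqE_nat)
qed

text \<open>The valuation at \<open>p\<close> is \<open>m\<close> times the 2-adic one, and
  \<open>m\<close> is even because \<open>s\<close> is at least 3.\<close>

lemma int_p_factor:
  fixes N :: int
  assumes "N \<noteq> 0"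
  obtains v y where "even v" "p_odd y" "of_int N = p ^ v * y"
proof -
  define k where "k = multiplicity 2 N"
  obtain o' where ko: "N = 2 ^ k * o'" "odd o'"
    unfolding k_def using multiplicity_decompose'[of N 2] assms by auto
  have w: "alg_unit (2 / p ^ m)" using alg_unit_inverse[OF alg_unit_p_power] by simp
  have "2 / p ^ m \<in> F" by (intro F_intros) auto
  hence "p_odd ((2 / p ^ m) ^ k)" by (intro p_odd_power p_odd_unit w)
  moreover have "p_odd (of_int o')" using ko Ou_of_int even_if_p_dvd by (auto simp: p_odd_def)
  ultimately have "p_odd ((2 / p ^ m) ^ k * of_int o')" by (rule p_odd_mult)
  moreover have "of_int N = p ^ (m * k) * ((2 / p ^ m) ^ k * of_int o')"
    by (simp add: ko power_divide power_mult)
  moreover have "even (m * k)" using even_m by simp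
  ultimately show ?thesis using that by blast
qed

text \<open>The valuation at \<open>p\<close> is odd on the left and, by
  \<open>int_p_factor\<close>, even on the right.\<close>

lemma p_unit_square_not_rational:
  assumes "alg_unit \<epsilon>" "\<epsilon> \<in> F" "x \<in> F" "x \<noteq> 0" "B \<noteq> 0"
  shows "p * \<epsilon> * x\<^sup>2 \<noteq> of_int A / of_int B"
proof
  assume eq: "p * \<epsilon> * x\<^sup>2 = of_int A / of_int B"
  obtain f N where N: "N \<noteq> 0" "x = ipoly f c / of_int N" using assms(3) by (elim F_E)
  define y where "y = ipoly f c"
  have y: "y \<in> Ou" "y \<noteq> 0" using N assms(4) by (auto simp: y_def Ou_iff)
  obtain v y' where v: "p_odd y'" "y = p ^ v * y'" using p_factor[OF y] by blast
  obtain b B' where b: "even b" "p_odd B'" "of_int B = p ^ b * B'" using int_p_factor[OF assms(5)] by blast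
  have "of_int A \<noteq> (0 :: complex)"
    using eq assms alg_unit_nonzero by auto
  hence "A * N\<^sup>2 \<noteq> 0" using N by simp
  then obtain a A' where a: "even a" "p_odd A'" "of_int (A * N\<^sup>2) = p ^ a * A'"
    using int_p_factor by blast
  have "p * \<epsilon> * y\<^sup>2 * of_int B = of_int (A * N\<^sup>2)"
    using eq N assms(5) by (simp add: y_def field_simps power2_eq_square)
  hence "p ^ (1 + 2 * v + b) * (\<epsilon> * y'\<^sup>2 * B') = p ^ a * A'"
    unfolding a b(3) v(2) by (simp add: power_add power_mult power_mult_distrib power2_eq_square mult_ac)
  moreover have "p_odd (\<epsilon> * y'\<^sup>2 * B')"
    using assms v b by (intro p_odd_mult p_odd_power) (auto intro: p_odd_unit)
  ultimately have "1 + 2 * v + b = a" using a by (intro p_factor_unique)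
  thus False using a(1) b(1) by presburger
qed

section \<open>The residue class of 3 as a generator of the Galois group\<close>

lemma four_m_dvd_three_power: "4 * m dvd 3 ^ m - 1"
proof (rule m_eq)
  fix k assume k: "s = k + 3" "m = 2 ^ (k + 1)"
  have "4 * m = 2 ^ (k + 3)" using two_power_s k(1) by metis
  thus ?thesis using three_power_cong_one[of k] k(2) by metis
qed

lemma e_three_power_m: "e (3 ^ m) = e 1"
proof -
  have "(3::nat) ^ m = (3 ^ m - 1) + 1" by simp
  hence "\<zeta> ^ (3 ^ m) = \<zeta> ^ (3 ^ m - 1) * \<zeta> ^ 1" by (metis power_add)
  also have "\<zeta> ^ (3 ^ m - 1) = 1" using four_m_dvd_three_power by (simp only: zeta_power_eq_1_iff)
  finally show ?thesis by (simp only: e_eq_iff) simp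
qed

lemma sg_three_power_m: "x \<in> F \<Longrightarrow> sg (3 ^ m) x = x"
  using sg_cong_e[of "3 ^ m" 1 x] e_three_power_m sg_one_id by simp

text \<open>A coincidence would make \<open>3 ^ (j - i)\<close> congruent to 1 or -1 modulo
  \<open>4 * m\<close>. The first is excluded by the order of 3, the second already modulo
  8.\<close>

lemma e_three_power_inj: "inj_on (\<lambda>k. e (3 ^ k)) {..<m}"
proof (rule inj_onI)
  have *: False if ij: "i < j" "j < m" and eq: "e (3 ^ i) = e (3 ^ j)" for i j
  proof -
    obtain d where d: "j = i + d" "d > 0" using ij(1) less_imp_add_positive by blast
    have cop: "coprime (4 * m) ((3::nat) ^ i)" by (simp flip: two_power_s)
    from eq consider "\<zeta> ^ (3 ^ i) = \<zeta> ^ (3 ^ j)" | "\<zeta> ^ (3 ^ i + 3 ^ j) = 1" by (auto simp: e_eq_iff)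
    thus False
    proof cases
      case 1
      have "(3::nat) ^ j = 3 ^ i + 3 ^ i * (3 ^ d - 1)" by (simp add: d power_add algebra_simps)
      hence "\<zeta> ^ (3 ^ j) = \<zeta> ^ (3 ^ i) * \<zeta> ^ (3 ^ i * (3 ^ d - 1))" by (simp only: power_add)
      hence "\<zeta> ^ (3 ^ i * (3 ^ d - 1)) = 1" using 1 by simp
      hence "4 * m dvd 3 ^ i * (3 ^ d - 1)" by (simp only: zeta_power_eq_1_iff)
      hence "4 * m dvd 3 ^ d - 1" using coprime_dvd_mult_right_iff[OF cop] by blast
      hence "m dvd d"
        by (rule_tac m_eq) (metis two_power_dvd_three_power_minus_one two_power_s)
      thus False using d ij by (auto dest: dvd_imp_le)
    next
      case 2
      have "(3::nat) ^ i + 3 ^ j = 3 ^ i * (1 + 3 ^ d)" by (simp add: d power_add algebra_simps)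
      hence "4 * m dvd 3 ^ i * (1 + 3 ^ d)" using 2 by (simp only: zeta_power_eq_1_iff)
      hence *: "4 * m dvd 1 + 3 ^ d" using coprime_dvd_mult_right_iff[OF cop] by blast
      have "2 ^ 3 dvd (2::nat) ^ s" by (rule le_imp_power_dvd) (rule s_ge)
      hence "8 dvd 4 * m" by (simp add: two_power_s)
      hence "8 dvd 1 + (3::nat) ^ d" using * by (rule dvd_trans)
      thus False using not_eight_dvd_one_plus_three_power by blast
    qed
  qed
  fix i j assume "i \<in> {..<m}" "j \<in> {..<m}" "e (3 ^ i) = e (3 ^ j)"
  thus "i = j" using *[of i j] *[of j i] by (metis lessThan_iff linorder_neqE_nat)
qed

text \<open>The numerator, reduced to degree below \<open>m\<close>, takes the same value at the
  \<open>m\<close> distinct conjugates of \<open>c\<close>, so it is constant.\<close>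

lemma fixed_rational:
  assumes x: "x \<in> F" and fx: "sg 3 x = x"
  obtains A B where "B \<noteq> 0" "x = of_int A / of_int B"
proof -
  obtain f N where N: "N \<noteq> 0" "x = ipoly f c / of_int N" using x by (elim F_E)
  obtain r where r: "degree r < m" "\<And>a. odd a \<Longrightarrow> ipoly f (e a) = ipoly r (e a)"
    using ipoly_c_reduce[of f] by blast
  have fixk: "sg (3 ^ k) x = x" for k
  proof (induction k)
    case (Suc k)
    have "sg (3 ^ Suc k) x = sg 3 (sg (3 ^ k) x)" using x by (simp add: sg_sg)
    thus ?case using Suc fx by simp
  qed (use sg_one_id x in simp)
  have val: "ipoly r (e (3 ^ k)) = of_int N * x" for k
    using fixk[of k] N(1) sg_eq[of "3 ^ k" N f] by (simp add: N(2) r(2) field_simps)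
  define R where "R = map_poly of_int r - [:of_int N * x:]"
  have degR: "degree R < m"
    using r(1) unfolding R_def by (intro degree_diff_less) (auto simp: m_pos)
  have "R = 0"
  proof (rule ccontr)
    assume R: "R \<noteq> 0"
    have "(\<lambda>k. e (3 ^ k)) ` {..<m} \<subseteq> {z. poly R z = 0}" using val by (auto simp: R_def)
    hence "card ((\<lambda>k. e (3 ^ k)) ` {..<m}) \<le> card {z. poly R z = 0}"
      using R poly_roots_finite by (intro card_mono) auto
    also have "\<dots> \<le> degree R" by (rule card_poly_roots_bound[OF R])
    finally show False using degR card_image[OF e_three_power_inj] by simp
  qed
  hence "coeff (map_poly of_int r) 0 = (of_int N * x :: complex)"
    unfolding R_def by (metis coeff_pCons_0 eq_iff_diff_eq_0)
  hence "x = of_int (coeff r 0) / of_int N" using N(1) by (simp add: field_simps)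
  thus ?thesis using that N(1) by blast
qed

section \<open>The norm to the rationals and Hilbert 90\<close>

definition Nm :: "complex \<Rightarrow> complex" where "Nm x = (\<Prod>k<m. sg (3 ^ k) x)"

lemma Nm_mult: "x \<in> F \<Longrightarrow> y \<in> F \<Longrightarrow> Nm (x * y) = Nm x * Nm y"
  by (simp add: Nm_def sg_mult prod.distrib)

text \<open>The norm of \<open>sg 3 g / g\<close> telescopes to 1 because \<open>sg (3 ^ m)\<close>
  is the identity on \<open>F\<close>.\<close>

lemma Nm_of_quotient:
  assumes g: "g \<in> F" "g \<noteq> 0" and h: "h \<in> F" "h\<^sup>2 = sg 3 g / g"
  shows "Nm h = 1 \<or> Nm h = -1"
proof -
  have nz: "sg (3 ^ k) g \<noteq> 0" for k using g sg_nonzero by simp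
  have "(Nm h)\<^sup>2 = (\<Prod>k<m. sg (3 ^ k) (h\<^sup>2))"
    using h(1) by (simp add: Nm_def prod_power_distrib sg_power)
  also have "\<dots> = (\<Prod>k<m. sg (3 ^ Suc k) g / sg (3 ^ k) g)"
    using g by (intro prod.cong refl) (simp add: h(2) sg_divide sg_in_F sg_sg mult.commute)
  also have "\<dots> = sg (3 ^ m) g / sg (3 ^ 0) g"
    using nz by (intro prod_lessThan_telescope) auto
  also have "\<dots> = 1" using sg_three_power_m[OF g(1)] sg_one_id[OF g(1)] g(2) by simp
  finally show ?thesis by (simp add: power2_eq_1_iff)
qed

text \<open>Hilbert 90 for \<open>\<sigma> = sg 3\<close>, a generator of the Galois group: for \<open>Nm h = 1\<close> a Lagrange resolvent \<open>x\<close> of \<open>h\<close> satisfies \<open>h = x / \<sigma> x\<close>,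
  so that \<open>g x\<^sup>2\<close> is fixed by \<open>\<sigma>\<close>.\<close>

lemma hilbert_90_square:
  assumes g: "g \<in> F" "g \<noteq> 0" and h: "h \<in> F" "h\<^sup>2 = sg 3 g / g" and N1: "Nm h = 1"
  obtains x A B where "x \<in> F" "x \<noteq> 0" "B \<noteq> 0" "g * x\<^sup>2 = of_int A / of_int B"
proof -
  \<comment> \<open>The cocycle of \<open>h\<close>; the norm condition says that it closes up,
    \<open>b m = 1\<close>.\<close>
  define b where "b k = (\<Prod>i<k. sg (3 ^ i) h)" for k :: nat
  have bF: "b k \<in> F" for k unfolding b_def using h by (intro F_prod sg_in_F) auto
  have bs: "sg 3 (b k) * h = b (Suc k)" for k
  proof -
    have "sg 3 (b k) = (\<Prod>i<k. sg (3 ^ Suc i) h)"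
      unfolding b_def using h by (subst sg_prod) (auto simp: sg_in_F sg_sg)
    moreover have "sg (3 ^ 0) h = h" using sg_one_id[OF h(1)] by simp
    ultimately show ?thesis unfolding b_def prod.lessThan_Suc_shift by simp
  qed
  have b0: "b 0 = 1" and bm: "b m = 1" using N1 by (auto simp: b_def Nm_def)
  define x where "x \<theta> = (\<Sum>k<m. b k * sg (3 ^ k) \<theta>)" for \<theta>
  have xF: "x \<theta> \<in> F" if "\<theta> \<in> F" for \<theta>
    unfolding x_def using that bF by (intro F_sum F_mult sg_in_F) auto
  have xs: "sg 3 (x \<theta>) * h = x \<theta>" if \<theta>: "\<theta> \<in> F" for \<theta>
  proof -
    have "sg 3 (x \<theta>) = (\<Sum>k<m. sg 3 (b k) * sg (3 ^ Suc k) \<theta>)"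
      unfolding x_def using \<theta> bF
      by (subst sg_sum) (auto simp: sg_mult sg_in_F sg_sg F_mult)
    hence "sg 3 (x \<theta>) * h = (\<Sum>k<m. b (Suc k) * sg (3 ^ Suc k) \<theta>)"
      by (simp add: sum_distrib_right sum_distrib_left bs[symmetric] mult_ac del: power_Suc)
    \<comment> \<open>The sum over one term more than a full cycle is split at either end; the terms
      at 0 and at \<open>m\<close> both equal \<theta>.\<close>
    moreover have "(\<Sum>k<Suc m. b k * sg (3 ^ k) \<theta>) = x \<theta> + \<theta>"
      unfolding x_def using sg_three_power_m[OF \<theta>] bm by simp
    moreover have "(\<Sum>k<Suc m. b k * sg (3 ^ k) \<theta>) = \<theta> + (\<Sum>k<m. b (Suc k) * sg (3 ^ Suc k) \<theta>)"
      unfolding sum.lessThan_Suc_shift using b0 sg_one_id[OF \<theta>] by simp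
    ultimately show ?thesis by simp
  qed
  have "\<exists>j. x (c ^ j) \<noteq> 0"
  proof (rule ccontr)
    assume "\<nexists>j. x (c ^ j) \<noteq> 0"
    hence z: "(\<Sum>k<m. b k * e (3 ^ k) ^ j) = 0" for j
      by (simp add: x_def sg_power sg_c)
    have lin: "(\<Sum>k<m. b k * poly P (e (3 ^ k))) = 0" for P
    proof -
      have "(\<Sum>k<m. b k * poly P (e (3 ^ k)))
          = (\<Sum>k<m. \<Sum>j\<le>degree P. coeff P j * (b k * e (3 ^ k) ^ j))"
        by (simp add: poly_altdef sum_distrib_left mult_ac)
      also have "\<dots> = (\<Sum>j\<le>degree P. coeff P j * (\<Sum>k<m. b k * e (3 ^ k) ^ j))"
        by (subst sum.swap) (simp add: sum_distrib_left)
      also have "\<dots> = 0" by (simp add: z)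
      finally show ?thesis .
    qed
    \<comment> \<open>Independence of the conjugations by interpolation: \<open>P\<close> kills
      every conjugate except \<open>c\<close> itself, which enters with coefficient
      \<open>b 0 = 1\<close>.\<close>
    define P where "P = (\<Prod>k=1..<m. [:- e (3 ^ k), 1:])"
    have P0: "poly P (e (3 ^ k)) = 0" if "k \<in> {1..<m}" for k
      unfolding P_def poly_prod using that by (intro prod_zero) auto
    have "poly P (e (3 ^ 0)) \<noteq> 0"
    proof
      assume "poly P (e (3 ^ 0)) = 0"
      then obtain k where "k \<in> {1..<m}" "e (3 ^ k) = e (3 ^ 0)"
        unfolding P_def poly_prod by auto
      thus False using inj_onD[OF e_three_power_inj, of k 0] by auto
    qed
    moreover have "{..<m} = insert 0 {1..<m}" using m_pos by auto
    hence "(\<Sum>k<m. b k * poly P (e (3 ^ k))) = poly P (e (3 ^ 0))"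
      using b0 P0 by simp
    ultimately show False using lin[of P] by simp
  qed
  then obtain j where j: "x (c ^ j) \<noteq> 0" by blast
  define y where "y = x (c ^ j)"
  have y: "y \<in> F" "y \<noteq> 0" "sg 3 y * h = y" using j xF xs by (auto simp: y_def F_power)
  have "sg 3 (g * y\<^sup>2) = sg 3 g * (sg 3 y)\<^sup>2" using g y by (simp add: sg_mult sg_power F_power)
  also have "sg 3 g = h\<^sup>2 * g" using h(2) g(2) by (simp add: field_simps)
  also have "h\<^sup>2 * g * (sg 3 y)\<^sup>2 = g * (sg 3 y * h)\<^sup>2" by (simp add: power_mult_distrib)
  finally have "sg 3 (g * y\<^sup>2) = g * y\<^sup>2" unfolding y(3) .
  moreover have "g * y\<^sup>2 \<in> F" using g y by (intro F_intros)
  ultimately obtain A B where "B \<noteq> 0" "g * y\<^sup>2 = of_int A / of_int B" using fixed_rational by metis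
  thus ?thesis using that y by blast
qed

section \<open>Odd primes are unramified in \<open>F\<close>\<close>

lemma algebraic_int_frobenius:
  assumes "prime l" "odd l" "y \<in> Ou"
  shows "algebraic_int ((y ^ l - sg l y) / of_nat l)"
proof -
  from assms(3) obtain f where y: "y = ipoly f c" by (auto simp: Ou_iff)
  have ce: "algebraic_int ((c ^ l - e l) / of_nat l)"
    using algebraic_int_frobenius_add[OF assms(1) algebraic_int_zeta]
    by (simp add: c_def e_def algebra_simps)
  have "algebraic_int ((ipoly f c ^ l - ipoly f (e l)) / of_nat l)"
  proof (induction f)
    case 0
    thus ?case using prime_gt_0_nat[OF assms(1)] by (simp add: zero_power)
  next
    case (pCons k f)
    let ?x = "ipoly f c" and ?y = "ipoly f (e l)"
    have x: "algebraic_int ?x" and y: "algebraic_int ?y" by (auto intro!: algebraic_int_ipoly)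
    \<comment> \<open>One Horner step modulo \<open>l\<close>: the binomial congruence for the sum,
      Fermat for \<open>k\<close>, the induction hypothesis for \<open>?x\<close>, and
      \<open>c ^ l\<close> against \<open>e l\<close>.\<close>
    have "algebraic_int (((of_int k + c * ?x) ^ l - of_int k ^ l - (c * ?x) ^ l) / of_nat l
       + (of_int k ^ l - of_int k) / of_nat l
       + c ^ l * ((?x ^ l - ?y) / of_nat l) + ?y * ((c ^ l - e l) / of_nat l))"
      using algebraic_int_frobenius_add[OF assms(1), of "of_int k" "c * ?x"]
        algebraic_int_fermat[OF assms(1), of k] pCons.IH ce x y by blast
    also have "((of_int k + c * ?x) ^ l - of_int k ^ l - (c * ?x) ^ l) / of_nat l
       + (of_int k ^ l - of_int k) / of_nat l
       + c ^ l * ((?x ^ l - ?y) / of_nat l) + ?y * ((c ^ l - e l) / of_nat l)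
      = ((of_int k + c * ?x) ^ l - (of_int k + e l * ?y)) / of_nat l"
      by (simp add: add_divide_distrib[symmetric] power_mult_distrib algebra_simps)
    finally show ?case by (simp only: ipoly_pCons)
  qed
  thus ?thesis using assms(2) by (simp add: y sg_ipoly)
qed

text \<open>Odd primes do not ramify: the Frobenius lift \<open>sg l\<close> is injective, so there are no nilpotents modulo \<open>l\<close>.\<close>

lemma odd_prime_square_dvd:
  assumes l: "prime l" "odd l" and y: "y \<in> Ou" "algebraic_int (y\<^sup>2 / of_nat l)"
  shows "algebraic_int (y / of_nat l)"
proof -
  have l2: "l \<ge> 2" using l(1) by (rule prime_ge_2_nat)
  then obtain d where d: "l = 2 + d" using le_Suc_ex by blast
  have "algebraic_int (y\<^sup>2 / of_nat l * y ^ d)" using y Ou_algebraic_int by blast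
  moreover have "y\<^sup>2 / of_nat l * y ^ d = y ^ l / of_nat l"
    by (simp only: d power_add times_divide_eq_left)
  ultimately have "algebraic_int (y ^ l / of_nat l - (y ^ l - sg l y) / of_nat l)"
    using algebraic_int_frobenius[OF l y(1)] by auto
  moreover have "sg l (of_nat l) = of_nat l" using l(2) sg_of_int[of l "int l"] by simp
  moreover have lF: "of_nat l \<in> F" using of_int_in_F[of "int l"] by simp
  ultimately have "algebraic_int (sg l (y / of_nat l))"
    using l(2) Ou_in_F[OF y(1)] by (simp add: sg_divide diff_divide_distrib)
  thus ?thesis using algebraic_int_sg[OF l(2)] Ou_in_F[OF y(1)] lF F_divide by blast
qed

text \<open>Descent on the prime factors of \<open>R\<close>. A factor 2 is a square in
  \<open>F\<close>; an odd prime factor divides \<open>y\<close> and so occurs at least twice in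
  \<open>R\<close>.\<close>

lemma unit_times_square_eq_nat:
  assumes "alg_unit \<epsilon>" "\<epsilon> \<in> F" "y \<in> F" "\<epsilon> * y\<^sup>2 = of_nat R" "R > 0"
  shows "\<exists>\<eta>\<in>F. \<epsilon> = \<eta>\<^sup>2"
  using assms(3-)
proof (induction R arbitrary: y rule: less_induct)
  case (less R)
  have y0: "y \<noteq> 0" using less.prems by auto
  show ?case
  proof (cases "R = 1")
    case True
    hence "\<epsilon> = (inverse y)\<^sup>2" using less.prems y0 by (simp add: field_simps)
    thus ?thesis using less.prems F_inverse by blast
  next
    case False
    then obtain l where l: "prime l" "l dvd R" using prime_factor_nat by blast
    then obtain R' where R': "R = l * R'" by (elim dvdE)
    have l1: "l > 1" using l(1) by (rule prime_gt_1_nat)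
    show ?thesis
    proof (cases "l = 2")
      case True
      \<comment> \<open>A square root of 2 in \<open>F\<close>, by \<open>e_mult_e\<close> and the
        vanishing of \<open>e m\<close>.\<close>
      define w where "w = e (m div 2)"
      have "w\<^sup>2 = e m + 2" using e_mult_e[of "m div 2" "m div 2"] even_m
        by (simp add: w_def power2_eq_square flip: mult_2)
      also have "e m = 0" using e_mult_m[of 1] by simp
      finally have w: "w\<^sup>2 = 2" by simp
      have "\<epsilon> * (y / w)\<^sup>2 = of_nat R'"
        using less.prems(2) by (simp add: power_divide w R' True)
      moreover have "y / w \<in> F" using less.prems by (intro F_divide) (auto simp: w_def)
      ultimately show ?thesis using less.IH[of R' "y / w"] less.prems R' l1 by auto
    next
      case False
      have lo: "odd l" using l(1) False prime_odd_nat[of l] l1 by auto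
      have e0: "\<epsilon> \<noteq> 0" by (rule alg_unit_nonzero[OF assms(1)])
      have ie: "algebraic_int (inverse \<epsilon>)" using assms(1) by (simp add: alg_unit_def)
      have y2: "y\<^sup>2 = of_nat R * inverse \<epsilon>" using less.prems(2) e0 by (simp add: field_simps)
      have "algebraic_int (y\<^sup>2)" unfolding y2 using ie by blast
      hence "algebraic_int y" by (rule algebraic_int_of_power) simp
      hence yO: "y \<in> Ou" using less.prems F_algebraic_int_in_Ou by blast
      have "y\<^sup>2 / of_nat l = of_nat R' * inverse \<epsilon>" unfolding y2 R' using l1 by simp
      also have "algebraic_int \<dots>" using ie by blast
      finally have yl: "algebraic_int (y / of_nat l)" by (rule odd_prime_square_dvd[OF l(1) lo yO])
      have "algebraic_int (\<epsilon> * (y / of_nat l)\<^sup>2)" using yl assms(1) alg_unit_algebraic_int by blast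
      moreover have eq: "\<epsilon> * (y / of_nat l)\<^sup>2 = of_nat R / (of_nat l)\<^sup>2"
        using less.prems(2) by (simp add: power_divide)
      ultimately have "algebraic_int (of_int (int R) / of_int ((int l)\<^sup>2) :: complex)" by simp
      hence "(int l)\<^sup>2 dvd int R" by (rule algebraic_int_of_int_div) (use l1 in simp)
      hence "l\<^sup>2 dvd R" by (metis of_nat_dvd_iff of_nat_power)
      then obtain R2 where R2: "R = l\<^sup>2 * R2" by (elim dvdE)
      have "R2 < R" using R2 less.prems(3) one_less_power[OF l1, of 2] by simp
      moreover have "\<epsilon> * (y / of_nat l)\<^sup>2 = of_nat R2" unfolding eq R2 using l1 by simp
      moreover have "of_nat l \<in> F" using of_int_in_F[of "int l"] by simp
      ultimately show ?thesis
        using less.IH[of R2 "y / of_nat l"] less.prems R2 F_divide by auto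
    qed
  qed
qed

section \<open>Weber's theorem on totally positive units\<close>

lemma Re_mult_F: "x \<in> F \<Longrightarrow> y \<in> F \<Longrightarrow> Re (x * y) = Re x * Re y"
  using F_real[of x] F_real[of y] by (metis Re_complex_of_real of_real_mult)

text \<open>With \<open>y = x * B\<close> the right side becomes the integer \<open>A * B\<close>;
  it is positive because \<epsilon> is positive and \<open>y\<close> is real and nonzero.\<close>

lemma positive_unit_square_if_rational:
  assumes "alg_unit \<epsilon>" "\<epsilon> \<in> F" "Re \<epsilon> > 0" "x \<in> F" "x \<noteq> 0" "B \<noteq> 0"
    "\<epsilon> * x\<^sup>2 = of_int A / of_int B"
  shows "\<exists>\<eta>\<in>F. \<epsilon> = \<eta>\<^sup>2"
proof -
  define y where "y = x * of_int B"
  have y: "y \<in> F" "y \<noteq> 0" using assms by (auto simp: y_def F_mult)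
  have eq: "\<epsilon> * y\<^sup>2 = of_int (A * B)"
    using assms(6,7) by (simp add: y_def power_mult_distrib field_simps power2_eq_square)
  have "Re y \<noteq> 0" using y F_real[of y] by auto
  moreover have "Re (\<epsilon> * y\<^sup>2) = Re \<epsilon> * (Re y * Re y)"
    using assms y by (simp only: power2_eq_square Re_mult_F F_mult)
  ultimately have "Re (\<epsilon> * y\<^sup>2) > 0" using assms(3) by (simp add: zero_less_mult_iff) linarith
  hence AB: "A * B > 0" unfolding eq by (simp flip: of_int_mult)
  have "\<epsilon> * y\<^sup>2 = of_nat (nat (A * B))" using eq AB by (metis of_int_of_nat_eq int_nat_eq less_imp_le)
  thus ?thesis by (rule unit_times_square_eq_nat[OF assms(1,2) y(1)]) (use AB in simp)
qed

lemma positive_unit_square_step: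
  assumes "alg_unit \<epsilon>" "\<epsilon> \<in> F" "Re \<epsilon> > 0" "\<eta> \<in> F" "\<epsilon> * sg 3 \<epsilon> = \<eta>\<^sup>2"
  shows "\<exists>\<eta>\<in>F. \<epsilon> = \<eta>\<^sup>2"
proof -
  have e0: "\<epsilon> \<noteq> 0" by (rule alg_unit_nonzero[OF assms(1)])
  define h where "h = \<eta> / \<epsilon>"
  have "h\<^sup>2 = \<epsilon> * sg 3 \<epsilon> / \<epsilon>\<^sup>2" unfolding h_def assms(5) by (rule power_divide)
  hence h: "h \<in> F" "h\<^sup>2 = sg 3 \<epsilon> / \<epsilon>"
    using assms(2,4) e0 by (auto simp: h_def F_divide power2_eq_square)
  \<comment> \<open>Chosen for the identity \<open>2 + e 3 = (2 + c) * (c - 1)\<^sup>2\<close>,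
    which makes \<theta> for \<open>p\<close> what \<open>h\<close> is for \<epsilon>.\<close>
  define \<theta> where "\<theta> = c - 1"
  have "c * c = e 2 + 2" using e_mult_e[of 1 1] by (simp add: numeral_2_eq_2)
  moreover have "e 2 * c = e 3 + c" using e_mult_e[of 1 2] by (simp add: numeral_3_eq_3)
  ultimately have "e 3 = c * c * c - 3 * c" by (simp add: algebra_simps)
  hence "sg 3 p = p * \<theta>\<^sup>2"
    by (simp add: p_def \<theta>_def sg_add sg_c power2_eq_square algebra_simps)
  hence \<theta>: "\<theta> \<in> F" "\<theta>\<^sup>2 = sg 3 p / p" by (auto simp: \<theta>_def F_diff)
  from Nm_of_quotient[OF assms(2) e0 h] show ?thesis
  proof
    assume "Nm h = 1"
    from hilbert_90_square[OF assms(2) e0 h this] obtain x A B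
      where "x \<in> F" "x \<noteq> 0" "B \<noteq> 0" "\<epsilon> * x\<^sup>2 = of_int A / of_int B" .
    thus ?thesis using positive_unit_square_if_rational assms by blast
  next
    assume Nh: "Nm h = -1"
    \<comment> \<open>Norm 1 would make \<open>p\<close> a rational times a square. So \<theta> has
      norm -1 and corrects the sign of the norm of \<open>h\<close>.\<close>
    have "Nm \<theta> \<noteq> 1"
    proof
      assume "Nm \<theta> = 1"
      from hilbert_90_square[OF p_in_F p_nz \<theta> this] obtain x A B
        where x: "x \<in> F" "x \<noteq> 0" "B \<noteq> 0" "p * x\<^sup>2 = of_int A / of_int B" .
      thus False using p_unit_square_not_rational[of 1 x B A] by simp
    qed
    hence "Nm \<theta> = -1" using Nm_of_quotient[OF p_in_F p_nz \<theta>] by blast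
    hence N1: "Nm (h * \<theta>) = 1" using Nh h \<theta> by (simp add: Nm_mult)
    have pe: "p * \<epsilon> \<in> F" "p * \<epsilon> \<noteq> 0" using assms e0 by (auto intro: F_mult)
    have "h * \<theta> \<in> F" "(h * \<theta>)\<^sup>2 = sg 3 (p * \<epsilon>) / (p * \<epsilon>)"
      using h \<theta> assms by (auto simp: F_mult power_mult_distrib sg_mult mult.commute)
    from hilbert_90_square[OF pe this N1] obtain x A B
      where x: "x \<in> F" "x \<noteq> 0" "B \<noteq> 0" "p * \<epsilon> * x\<^sup>2 = of_int A / of_int B" .
    thus ?thesis using p_unit_square_not_rational[OF assms(1,2) x(1,2,3)] by blast
  qed
qed

definition totally_positive :: "complex \<Rightarrow> bool" where
  "totally_positive x \<longleftrightarrow> (\<forall>a. odd a \<longrightarrow> Re (sg a x) > 0)"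

text \<open>Written additively, \<open>(1 + \<sigma>) ^ (2 ^ j) = 1 + \<sigma> ^ (2 ^ j)\<close> modulo 2.\<close>

definition D :: "complex \<Rightarrow> complex" where "D x = x * sg 3 x"

lemma D_in_F: "x \<in> F \<Longrightarrow> D x \<in> F"
  by (simp add: D_def F_mult sg_in_F)

lemma D_iter_two_power:
  "x \<in> F \<Longrightarrow> \<exists>z\<in>F. (D ^^ (2 ^ j)) x = x * sg (3 ^ (2 ^ j)) x * z\<^sup>2"
proof (induction j arbitrary: x)
  case 0
  show ?case by (rule bexI[of _ 1]) (auto simp: D_def)
next
  case (Suc j)
  define a where "a = (3::nat) ^ (2 ^ j)"
  have a: "odd a" "3 ^ (2 ^ Suc j) = a * a" by (auto simp: a_def simp flip: power_add mult_2)
  define y where "y = (D ^^ (2 ^ j)) x"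
  obtain z where z: "z \<in> F" "y = x * sg a x * z\<^sup>2"
    using Suc.IH[OF Suc.prems] by (auto simp: y_def a_def)
  have yF: "y \<in> F" using z Suc.prems a by (auto intro!: F_intros sg_in_F)
  obtain w where w: "w \<in> F" "(D ^^ (2 ^ j)) y = y * sg a y * w\<^sup>2"
    using Suc.IH[OF yF] by (auto simp: a_def)
  have "(D ^^ (2 ^ Suc j)) x = (D ^^ (2 ^ j)) y"
    by (simp add: y_def mult_2 funpow_add)
  also have "\<dots> = y * sg a y * w\<^sup>2" by (rule w)
  also have "sg a y = sg a x * sg (a * a) x * (sg a z)\<^sup>2"
    using z Suc.prems a by (simp add: sg_mult sg_power sg_sg F_mult F_power sg_in_F)
  \<comment> \<open>The middle conjugate \<open>sg a x\<close> occurs twice and is absorbed in the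
    square.\<close>
  also have "y * (sg a x * sg (a * a) x * (sg a z)\<^sup>2) * w\<^sup>2
      = x * sg (a * a) x * (sg a x * z * sg a z * w)\<^sup>2"
    by (simp add: z(2) power2_eq_square)
  finally have "(D ^^ (2 ^ Suc j)) x = x * sg (3 ^ (2 ^ Suc j)) x * (sg a x * z * sg a z * w)\<^sup>2"
    by (simp only: a)
  moreover have "sg a x * z * sg a z * w \<in> F"
    using z w a Suc.prems by (intro F_mult sg_in_F)
  ultimately show ?case by blast
qed

text \<open>\<open>D ^^ m\<close> sends \<epsilon> to a square because \<open>sg (3 ^ m)\<close> is
  the identity on \<open>F\<close>. Being a square is then pulled back through the iterates one at a
  time, since all of them are totally positive units.\<close>

theorem totally_positive_unit_square:
  assumes "alg_unit \<epsilon>" "\<epsilon> \<in> F" "totally_positive \<epsilon>"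
  shows "\<exists>\<eta>\<in>F. \<epsilon> = \<eta>\<^sup>2"
proof -
  have step: "\<exists>\<eta>\<in>F. \<epsilon> = \<eta>\<^sup>2"
    if "alg_unit \<epsilon>" "\<epsilon> \<in> F" "totally_positive \<epsilon>" "\<exists>\<eta>\<in>F. (D ^^ k) \<epsilon> = \<eta>\<^sup>2" for k \<epsilon>
    using that
  proof (induction k arbitrary: \<epsilon>)
    case (Suc k)
    have "totally_positive (D \<epsilon>)"
      unfolding totally_positive_def
    proof (intro allI impI)
      fix a :: nat assume a: "odd a"
      have "sg a (D \<epsilon>) = sg a \<epsilon> * sg (a * 3) \<epsilon>"
        using Suc.prems a by (simp add: D_def sg_mult sg_in_F sg_sg)
      moreover have "Re (sg a \<epsilon>) > 0" "Re (sg (a * 3) \<epsilon>) > 0"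
        using Suc.prems(3) a by (auto simp: totally_positive_def)
      moreover have "Re (sg a \<epsilon> * sg (a * 3) \<epsilon>) = Re (sg a \<epsilon>) * Re (sg (a * 3) \<epsilon>)"
        using Suc.prems a by (intro Re_mult_F sg_in_F) auto
      ultimately show "Re (sg a (D \<epsilon>)) > 0" by (simp only: mult_pos_pos)
    qed
    moreover have "alg_unit (D \<epsilon>)" using Suc.prems by (simp add: D_def alg_unit_mult alg_unit_sg)
    moreover have "\<exists>\<eta>\<in>F. (D ^^ k) (D \<epsilon>) = \<eta>\<^sup>2" using Suc.prems(4) by (simp add: funpow_swap1)
    ultimately have "\<exists>\<eta>\<in>F. D \<epsilon> = \<eta>\<^sup>2" using Suc.IH[of "D \<epsilon>"] Suc.prems D_in_F by blast
    moreover have "Re \<epsilon> > 0"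
      using Suc.prems(3) sg_one_id[OF Suc.prems(2)] unfolding totally_positive_def by (metis odd_one)
    ultimately show ?case using positive_unit_square_step Suc.prems(1,2) unfolding D_def by blast
  qed simp
  obtain z where "z \<in> F" "(D ^^ m) \<epsilon> = \<epsilon> * sg (3 ^ m) \<epsilon> * z\<^sup>2"
    using D_iter_two_power[OF assms(2), of "s - 2"] by (auto simp: m_def)
  hence "(D ^^ m) \<epsilon> = (\<epsilon> * z)\<^sup>2" "\<epsilon> * z \<in> F"
    using sg_three_power_m[OF assms(2)] assms(2) by (auto simp: power2_eq_square F_mult)
  thus ?thesis using step[OF assms] by blast
qed

end

section \<open>Quadratic extensions\<close>

lemma subfield_closed:
  assumes "is_subfield E"
  shows "0 \<in> E" "1 \<in> E" "\<And>x y. x \<in> E \<Longrightarrow> y \<in> E \<Longrightarrow> x + y \<in> E"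
    "\<And>x y. x \<in> E \<Longrightarrow> y \<in> E \<Longrightarrow> x * y \<in> E" "\<And>x. x \<in> E \<Longrightarrow> - x \<in> E"
    "\<And>x. x \<in> E \<Longrightarrow> inverse x \<in> E" "\<And>x y. x \<in> E \<Longrightarrow> y \<in> E \<Longrightarrow> x - y \<in> E"
    "\<And>x y. x \<in> E \<Longrightarrow> y \<in> E \<Longrightarrow> x / y \<in> E" "\<And>x k. x \<in> E \<Longrightarrow> x ^ k \<in> E"
proof -
  show *: "0 \<in> E" "1 \<in> E" "\<And>x y. x \<in> E \<Longrightarrow> y \<in> E \<Longrightarrow> x + y \<in> E"
    "\<And>x y. x \<in> E \<Longrightarrow> y \<in> E \<Longrightarrow> x * y \<in> E" "\<And>x. x \<in> E \<Longrightarrow> - x \<in> E"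
    using assms by (auto simp: is_subfield_def)
  show inv: "inverse x \<in> E" if "x \<in> E" for x
    using assms that by (cases "x = 0") (auto simp: is_subfield_def)
  show "x - y \<in> E" if "x \<in> E" "y \<in> E" for x y using *(3)[of x "- y"] *(5)[of y] that by simp
  show "x / y \<in> E" if "x \<in> E" "y \<in> E" for x y using *(4) inv that by (simp add: divide_inverse)
  show "x ^ k \<in> E" if "x \<in> E" for x k using that * by (induction k) auto
qed

lemma is_subfield_field_gen: "is_subfield (field_gen S)"
  unfolding field_gen_def is_subfield_def by auto

lemma field_gen_incl: "S \<subseteq> field_gen S"
  unfolding field_gen_def by auto

lemma field_gen_least: "is_subfield E \<Longrightarrow> S \<subseteq> E \<Longrightarrow> field_gen S \<subseteq> E"
  unfolding field_gen_def by auto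

lemma (in two_power_cyclotomic) Re_sg_mult:
  assumes "odd a" "x \<in> F" "y \<in> F"
  shows "Re (sg a (x * y)) = Re (sg a x) * Re (sg a y)"
  unfolding sg_mult[OF assms]
  by (rule Re_mult_F[OF sg_in_F[OF assms(1,2)] sg_in_F[OF assms(1,3)]])

locale totally_complex_quadratic = two_power_cyclotomic +
  fixes L :: "complex set" and \<delta> :: complex
  assumes L_field: "is_subfield L"
    and delta_notin: "\<delta> \<notin> F" and delta_sq: "\<delta>\<^sup>2 \<in> F"
    and L_eq: "L = {x + y * \<delta> | x y. x \<in> F \<and> y \<in> F}"
    and L_tc: "totally_complex L"
begin

lemmas L_closed = subfield_closed[OF L_field]

lemma delta_nz [simp]: "\<delta> \<noteq> 0"
  using delta_notin by auto

lemma L_E: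
  assumes "z \<in> L"
  obtains x y where "x \<in> F" "y \<in> F" "z = x + y * \<delta>"
  using assms L_eq by auto

lemma L_I: "x \<in> F \<Longrightarrow> y \<in> F \<Longrightarrow> x + y * \<delta> \<in> L"
  using L_eq by auto

lemma F_in_L: "x \<in> F \<Longrightarrow> x \<in> L"
  using L_I[of x 0] by simp

lemma delta_in_L: "\<delta> \<in> L"
  using L_I[of 0 1] by simp

lemma L_coords_unique:
  assumes "x \<in> F" "y \<in> F" "x' \<in> F" "y' \<in> F" "x + y * \<delta> = x' + y' * \<delta>"
  shows "x = x' \<and> y = y'"
proof -
  have "y = y'"
  proof (rule ccontr)
    assume "y \<noteq> y'"
    hence "\<delta> = (x' - x) / (y - y')" using assms(5) by (simp add: field_simps)
    thus False using assms delta_notin F_divide F_diff by metis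
  qed
  thus ?thesis using assms(5) by simp
qed

text \<open>Meaningful on \<open>L\<close> only, where \<open>L_coords_unique\<close> makes the
  description single-valued.\<close>

definition tau :: "complex \<Rightarrow> complex" where
  "tau z = (THE w. \<exists>x\<in>F. \<exists>y\<in>F. z = x + y * \<delta> \<and> w = x - y * \<delta>)"

lemma tau_eq: "x \<in> F \<Longrightarrow> y \<in> F \<Longrightarrow> tau (x + y * \<delta>) = x - y * \<delta>"
  unfolding tau_def by (rule the_equality) (blast, use L_coords_unique in blast)

lemma tau_F: "x \<in> F \<Longrightarrow> tau x = x"
  using tau_eq[of x 0] by simp

lemma tau_in_L: "z \<in> L \<Longrightarrow> tau z \<in> L"
  by (elim L_E) (simp add: tau_eq L_closed F_in_L delta_in_L)

lemma tau_tau: "z \<in> L \<Longrightarrow> tau (tau z) = z"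
proof (elim L_E)
  fix x y assume "x \<in> F" "y \<in> F" "z = x + y * \<delta>"
  thus ?thesis using tau_eq[of x y] tau_eq[of x "- y"] F_minus[of y] by simp
qed

lemma tau_add: "z \<in> L \<Longrightarrow> w \<in> L \<Longrightarrow> tau (z + w) = tau z + tau w"
proof (elim L_E)
  fix x y x' y' assume *: "x \<in> F" "y \<in> F" "z = x + y * \<delta>" "x' \<in> F" "y' \<in> F" "w = x' + y' * \<delta>"
  hence tau: "tau z = x - y * \<delta>" "tau w = x' - y' * \<delta>" by (simp_all only: tau_eq)
  have "z + w = (x + x') + (y + y') * \<delta>" using * by (simp add: algebra_simps)
  hence "tau (z + w) = (x + x') - (y + y') * \<delta>" using * tau_eq F_add by metis
  thus ?thesis unfolding tau by (simp add: algebra_simps)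
qed

lemma tau_mult: "z \<in> L \<Longrightarrow> w \<in> L \<Longrightarrow> tau (z * w) = tau z * tau w"
proof (elim L_E)
  fix x y x' y' assume *: "x \<in> F" "y \<in> F" "z = x + y * \<delta>" "x' \<in> F" "y' \<in> F" "w = x' + y' * \<delta>"
  hence tau: "tau z = x - y * \<delta>" "tau w = x' - y' * \<delta>" by (simp_all only: tau_eq)
  have "z * w = (x * x' + y * y' * \<delta>\<^sup>2) + (x * y' + y * x') * \<delta>"
    using * by (simp add: algebra_simps power2_eq_square)
  moreover have "x * x' + y * y' * \<delta>\<^sup>2 \<in> F" "x * y' + y * x' \<in> F"
    using * delta_sq by (auto intro!: F_add F_mult)
  ultimately have "tau (z * w) = (x * x' + y * y' * \<delta>\<^sup>2) - (x * y' + y * x') * \<delta>"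
    using tau_eq by simp
  thus ?thesis unfolding tau by (simp add: algebra_simps power2_eq_square)
qed

lemma tau_power: "z \<in> L \<Longrightarrow> tau (z ^ k) = tau z ^ k"
  by (induction k) (auto simp: tau_mult tau_F L_closed)

lemma tau_nonzero: "z \<in> L \<Longrightarrow> z \<noteq> 0 \<Longrightarrow> tau z \<noteq> 0"
  using tau_tau[of z] tau_F[of 0] by auto

lemma tau_inverse: "z \<in> L \<Longrightarrow> tau (inverse z) = inverse (tau z)"
proof (cases "z = 0")
  case False
  assume z: "z \<in> L"
  have "tau z * tau (inverse z) = 1"
    using z False tau_mult[of z "inverse z"] L_closed(6)[of z] tau_F[of 1] by simp
  thus ?thesis by (simp add: inverse_unique)
qed (use tau_F[of 0] in simp)

lemma tau_fixed_iff: "z \<in> L \<Longrightarrow> tau z = z \<longleftrightarrow> z \<in> F"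
proof (elim L_E, rule iffI)
  fix x y assume *: "x \<in> F" "y \<in> F" "z = x + y * \<delta>" "tau z = z"
  hence "y * \<delta> = 0" using tau_eq[of x y] by simp
  thus "z \<in> F" using * by simp
qed (rule tau_F)

lemma trace_in_F: "z \<in> L \<Longrightarrow> z + tau z \<in> F"
  by (elim L_E) (simp add: tau_eq F_mult)

lemma norm_in_F: "z \<in> L \<Longrightarrow> z * tau z \<in> F"
proof -
  assume z: "z \<in> L"
  have "tau (z * tau z) = z * tau z" using z by (simp add: tau_mult tau_in_L tau_tau mult.commute)
  thus ?thesis using tau_fixed_iff z L_closed(4) tau_in_L by blast
qed

lemma algebraic_int_tau: "z \<in> L \<Longrightarrow> algebraic_int z \<Longrightarrow> algebraic_int (tau z)"
proof -
  assume z: "z \<in> L" and int: "algebraic_int z"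
  have "tau (ipoly f z) = ipoly f (tau z) \<and> ipoly f z \<in> L" for f
    using z by (induction f) (auto simp: ipoly_pCons tau_add tau_mult tau_F L_closed F_in_L)
  moreover from int obtain f where "ipoly f z = 0" "lead_coeff f = 1"
    unfolding algebraic_int_altdef_ipoly by blast
  ultimately have "ipoly f (tau z) = 0 \<and> lead_coeff f = 1" using tau_F[of 0] by (metis zero_in_F)
  thus ?thesis unfolding algebraic_int_altdef_ipoly by blast
qed

lemma alg_unit_tau: "z \<in> L \<Longrightarrow> alg_unit z \<Longrightarrow> alg_unit (tau z)"
  using algebraic_int_tau[of z] algebraic_int_tau[of "inverse z"] L_closed(6)[of z]
  by (simp add: alg_unit_def tau_nonzero tau_inverse)

lemma trace_in_Ou: "z \<in> L \<Longrightarrow> algebraic_int z \<Longrightarrow> z + tau z \<in> Ou"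
  using trace_in_F algebraic_int_tau F_algebraic_int_in_Ou by blast

lemma norm_in_Ou: "z \<in> L \<Longrightarrow> algebraic_int z \<Longrightarrow> z * tau z \<in> Ou"
  using norm_in_F algebraic_int_tau F_algebraic_int_in_Ou by blast

text \<open>Otherwise \<open>x + y \<delta> \<mapsto> \<sigma> x + \<sigma> y \<surd>(\<sigma> \<delta>\<^sup>2)\<close> would be a real embedding of \<open>L\<close>.\<close>

lemma delta_sq_totally_negative:
  assumes a: "odd a"
  shows "Re (sg a (\<delta>\<^sup>2)) < 0"
proof (rule ccontr)
  assume "\<not> Re (sg a (\<delta>\<^sup>2)) < 0"
  hence nonneg: "Re (sg a (\<delta>\<^sup>2)) \<ge> 0" by simp
  define r where "r = sqrt (Re (sg a (\<delta>\<^sup>2)))"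
  have r: "r * r = Re (sg a (\<delta>\<^sup>2))" using nonneg by (simp add: r_def)
  \<comment> \<open>The two quotients recover the coordinates of \<open>z\<close> with respect to 1
    and \<delta>.\<close>
  define \<sigma> where "\<sigma> z = Re (sg a ((z + tau z) / 2)) + Re (sg a ((z - tau z) / (2 * \<delta>))) * r" for z
  have eq: "\<sigma> (x + y * \<delta>) = Re (sg a x) + Re (sg a y) * r" if "x \<in> F" "y \<in> F" for x y
    using that by (simp add: \<sigma>_def tau_eq)
  have Rm: "Re (sg a (x * y)) = Re (sg a x) * Re (sg a y)" if "x \<in> F" "y \<in> F" for x y
    using that a by (intro Re_sg_mult)
  have Ra: "Re (sg a (x + y)) = Re (sg a x) + Re (sg a y)" if "x \<in> F" "y \<in> F" for x y
    using that a by (simp add: sg_add)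
  have "\<sigma> 1 = 1" using eq[of 1 0] a by simp
  moreover have "\<sigma> (z + w) = \<sigma> z + \<sigma> w \<and> \<sigma> (z * w) = \<sigma> z * \<sigma> w" if zL: "z \<in> L" and wL: "w \<in> L" for z w
  proof -
    obtain x y where z: "x \<in> F" "y \<in> F" "z = x + y * \<delta>" using zL by (elim L_E)
    obtain x' y' where w: "x' \<in> F" "y' \<in> F" "w = x' + y' * \<delta>" using wL by (elim L_E)
    have \<sigma>_zw: "\<sigma> z = Re (sg a x) + Re (sg a y) * r" "\<sigma> w = Re (sg a x') + Re (sg a y') * r"
      using z w by (simp_all only: eq)
    have "z + w = (x + x') + (y + y') * \<delta>" using z w by (simp add: algebra_simps)
    hence "\<sigma> (z + w) = Re (sg a (x + x')) + Re (sg a (y + y')) * r" using z w eq F_add by metis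
    also have "\<dots> = \<sigma> z + \<sigma> w" using z w unfolding \<sigma>_zw by (simp only: Ra) (simp add: algebra_simps)
    finally have 1: "\<sigma> (z + w) = \<sigma> z + \<sigma> w" .
    have "z * w = (x * x' + y * y' * \<delta>\<^sup>2) + (x * y' + y * x') * \<delta>"
      using z w by (simp add: algebra_simps power2_eq_square)
    hence "\<sigma> (z * w) = Re (sg a (x * x' + y * y' * \<delta>\<^sup>2)) + Re (sg a (x * y' + y * x')) * r"
      using z w delta_sq by (simp only: eq F_add F_mult)
    also have "\<dots> = Re (sg a x) * Re (sg a x') + Re (sg a y) * Re (sg a y') * (r * r)
        + (Re (sg a x) * Re (sg a y') + Re (sg a y) * Re (sg a x')) * r"
      using z w delta_sq by (simp only: Ra Rm F_mult F_add r)
    also have "\<dots> = \<sigma> z * \<sigma> w" unfolding \<sigma>_zw by (simp add: algebra_simps)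
    finally show ?thesis using 1 by blast
  qed
  ultimately show False using L_tc unfolding totally_complex_def by blast
qed

text \<open>For \<open>v = x + y * \<delta>\<close> of norm 1,
  \<open>x\<^sup>2 = 1 + y\<^sup>2 * \<delta>\<^sup>2\<close>, which is at most 1 at every real
  place because \<open>\<delta>\<^sup>2\<close> is totally negative; the trace is
  \<open>2 * x\<close>.\<close>

lemma norm_one_trace_bounded:
  assumes v: "v \<in> L" "v * tau v = 1" and a: "odd a"
  shows "norm (sg a (v + tau v)) \<le> 2"
proof -
  obtain x y where xy: "x \<in> F" "y \<in> F" "v = x + y * \<delta>" using v(1) by (elim L_E)
  have t: "v + tau v = 2 * x" using xy by (simp add: tau_eq)
  have "(x + y * \<delta>) * (x - y * \<delta>) = 1" using v(2) tau_eq[OF xy(1,2)] by (simp only: xy(3))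
  hence "x * x - y * y * \<delta>\<^sup>2 = 1" by (simp add: algebra_simps power2_eq_square)
  hence "x * x = 1 + y * y * \<delta>\<^sup>2" by (simp add: algebra_simps)
  hence "Re (sg a (x * x)) = Re (sg a (1 + y * y * \<delta>\<^sup>2))" by simp
  moreover have Rm: "Re (sg a (x * y)) = Re (sg a x) * Re (sg a y)" if "x \<in> F" "y \<in> F" for x y
    using that a by (intro Re_sg_mult)
  have "Re (sg a (1 + y * y * \<delta>\<^sup>2)) = 1 + Re (sg a (y * y * \<delta>\<^sup>2))"
    using xy delta_sq a F_mult by (subst sg_add) auto
  ultimately have "Re (sg a x) * Re (sg a x) = 1 + Re (sg a y) * Re (sg a y) * Re (sg a (\<delta>\<^sup>2))"
    using xy delta_sq by (simp only: Rm F_mult)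
  moreover have "Re (sg a y) * Re (sg a y) * Re (sg a (\<delta>\<^sup>2)) \<le> 0"
    using delta_sq_totally_negative[OF a] by (intro mult_nonneg_nonpos) auto
  ultimately have "(Re (sg a x))\<^sup>2 \<le> 1" by (simp add: power2_eq_square)
  hence "\<bar>Re (sg a x)\<bar> \<le> 1" by (simp add: abs_square_le_1)
  moreover have "norm (sg a x) = \<bar>Re (sg a x)\<bar>" using sg_real[OF a xy(1)] by (metis norm_of_real)
  ultimately show ?thesis unfolding t using a xy by (simp add: sg_mult norm_mult)
qed

text \<open>Kronecker: the powers of \<open>v\<close> are roots of finitely many quadratics \<open>X\<^sup>2 - t X + 1\<close>.\<close>

lemma norm_one_root_of_unity:
  assumes v: "v \<in> L" "v * tau v = 1" "algebraic_int v"
  obtains k where "k > 0" "v ^ k = 1"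
proof -
  let ?B = "{x \<in> Ou. \<forall>a. odd a \<longrightarrow> norm (sg a x) \<le> 2}"
  have v0: "v \<noteq> 0" using v(2) by auto
  have "range (\<lambda>j. v ^ j) \<subseteq> (\<Union>t\<in>?B. {w. poly [:1, - t, 1:] w = 0})"
  proof clarify
    fix j :: nat
    let ?w = "v ^ j"
    have w: "?w \<in> L" "?w * tau ?w = 1" "algebraic_int ?w"
      using v L_closed by (auto simp: tau_power simp flip: power_mult_distrib)
    have "?w + tau ?w \<in> ?B" using norm_one_trace_bounded w trace_in_Ou by blast
    moreover have "poly [:1, - (?w + tau ?w), 1:] ?w = 0"
      using w(2) by (simp add: algebra_simps)
    ultimately show "?w \<in> (\<Union>t\<in>?B. {w. poly [:1, - t, 1:] w = 0})" by blast
  qed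
  moreover have "finite (\<Union>t\<in>?B. {w. poly [:1, - t, 1:] w = 0})"
    by (intro finite_UN_I finite_bounded_conjugates poly_roots_finite) simp
  ultimately have "finite (range (\<lambda>j. v ^ j))" by (rule finite_subset)
  hence "\<not> inj (\<lambda>j. v ^ j)" using range_inj_infinite by blast
  then obtain i j where ij: "i \<noteq> j" "v ^ i = v ^ j" by (auto simp: inj_def)
  have *: "\<exists>k>0. v ^ k = 1" if "i < j" "v ^ i = v ^ j" for i j
  proof -
    have "v ^ j = v ^ i * v ^ (j - i)" using that(1) by (simp flip: power_add)
    hence "v ^ (j - i) = 1" using that(2) v0 by simp
    thus ?thesis using that(1) by (intro exI[of _ "j - i"]) simp
  qed
  have "\<exists>k>0. v ^ k = 1" using *[of i j] *[of j i] ij by (metis linorder_neqE_nat)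
  thus ?thesis using that by blast
qed

text \<open>Both fields are obtained from the real field \<open>F\<close> by adjoining \<i>, which
  equals \<open>\<zeta> ^ m\<close> up to sign.\<close>

lemma ii_in_L_imp:
  assumes "\<i> \<in> L"
  shows "L = field_gen {\<zeta>}"
proof
  let ?K = "field_gen {\<zeta>}"
  note K = subfield_closed[OF is_subfield_field_gen[of "{\<zeta>}"]]
  have zK: "\<zeta> \<in> ?K" using field_gen_incl by blast
  have "c \<in> ?K" unfolding c_def e_def using zK by (intro K)
  hence FK: "F \<subseteq> ?K" by (rule F_subset_subfield[OF is_subfield_field_gen])
  define w where "w = \<zeta> ^ m"
  have w2: "w\<^sup>2 = -1" using zeta_2m by (simp add: w_def mult.commute flip: power_mult)
  hence wi: "w = \<i> \<or> w = - \<i>"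
    by (metis i_squared power2_eq_iff power2_i)
  have "w \<in> ?K" unfolding w_def using zK by (rule K)
  hence iK: "\<i> \<in> ?K" using wi K(5)[of w] by auto
  obtain x y where xy: "x \<in> F" "y \<in> F" "\<i> = x + y * \<delta>" using assms by (elim L_E)
  have "\<i> \<notin> F" using F_real[of \<i>] by auto
  hence "y \<noteq> 0" using xy by auto
  hence "\<delta> = (\<i> - x) / y" using xy by (simp add: field_simps)
  moreover have "(\<i> - x) / y \<in> ?K" using iK FK xy by (intro K) auto
  ultimately have "\<delta> \<in> ?K" by (simp only:)
  thus "L \<subseteq> ?K" unfolding L_eq using FK K(3,4) by blast
  have wL: "w \<in> L" using wi assms L_closed by auto
  have w0: "w \<noteq> 0" by (simp add: w_def)
  have iw: "inverse w = - w" by (rule inverse_unique) (use w2 in \<open>simp add: power2_eq_square\<close>)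
  have mm: "m = Suc (m - 1)" using m_pos by simp
  have "w = \<zeta> * \<zeta> ^ (m - 1)" unfolding w_def by (subst mm) simp
  hence z1: "\<zeta> ^ (m - 1) = w * inverse \<zeta>" by simp
  \<comment> \<open>Multiplied by \<open>w\<close>, this becomes
    \<open>\<zeta> - inverse \<zeta>\<close>; adding \<open>c\<close> yields
    \<open>2 * \<zeta>\<close>.\<close>
  have "e (m - 1) = w * inverse \<zeta> + inverse w * \<zeta>"
    unfolding e_def power_inverse z1 by simp
  hence "w * e (m - 1) = w * (w * inverse \<zeta> + - w * \<zeta>)" unfolding iw by (simp only:)
  hence "w * e (m - 1) = w\<^sup>2 * (inverse \<zeta> - \<zeta>)" by (simp add: algebra_simps power2_eq_square)
  hence "\<zeta> = (c + w * e (m - 1)) / 2" unfolding w2 by (simp add: c_def e_def)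
  moreover have "(c + w * e (m - 1)) / 2 \<in> L" using wL F_in_L by (intro L_closed) auto
  ultimately have "\<zeta> \<in> L" by metis
  thus "?K \<subseteq> L" by (intro field_gen_least[OF L_field]) simp
qed

lemma Re_sg_p_pos: "odd a \<Longrightarrow> Re (sg a p) > 0"
proof -
  assume a: "odd a"
  have eq: "sg a p = 2 + e a" using a by (simp add: p_def sg_add sg_c)
  have "norm (e a) \<le> 2"
    using norm_triangle_ineq[of "\<zeta> ^ a" "inverse \<zeta> ^ a"]
    by (simp add: e_def norm_power norm_inverse norm_zeta)
  hence "Re (sg a p) \<ge> 0" using abs_Re_le_cmod[of "e a"] by (simp add: eq)
  moreover have "Re (sg a p) \<noteq> 0" using sg_nonzero[OF a p_in_F p_nz] sg_real[OF a p_in_F] by auto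
  ultimately show ?thesis by simp
qed

text \<open>Here \<open>q\<close> is an \<open>F\<close>-multiple of \<delta>, so
  \<open>- (q\<^sup>2 / p)\<close> is totally positive like \<open>- (\<delta>\<^sup>2)\<close> and
  \<open>p\<close>. It is a square \<open>\<eta>\<^sup>2\<close>, and \<open>q / \<eta>\<close> is a
  square root of \<open>- p\<close>.\<close>

lemma csqrt_case:
  assumes q: "q \<in> L" "q \<noteq> 0" "alg_unit (q\<^sup>2 / p)" "tau q = - q"
  shows "L = field_gen (insert (csqrt (- p)) F)"
proof -
  obtain x y where xy: "x \<in> F" "y \<in> F" "q = x + y * \<delta>" using q(1) by (elim L_E)
  have x0: "x = 0" using q(4) xy by (simp add: tau_eq)
  hence qd: "q = y * \<delta>" using xy by simp
  have y0: "y \<noteq> 0" using qd q(2) by auto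
  define \<epsilon> where "\<epsilon> = - (q\<^sup>2 / p)"
  have eps: "\<epsilon> = y * y * (- (\<delta>\<^sup>2)) / p" by (simp add: \<epsilon>_def qd power2_eq_square)
  have epsF: "\<epsilon> \<in> F" unfolding eps using xy delta_sq by (intro F_divide F_mult F_minus) auto
  have "totally_positive \<epsilon>"
    unfolding totally_positive_def
  proof (intro allI impI)
    fix a :: nat assume a: "odd a"
    have Rm: "Re (sg a (x * y)) = Re (sg a x) * Re (sg a y)" if "x \<in> F" "y \<in> F" for x y
      using that a by (intro Re_sg_mult)
    have "\<epsilon> * p = y * y * (- (\<delta>\<^sup>2))" unfolding eps by simp
    hence "Re (sg a (\<epsilon> * p)) = Re (sg a (y * y * (- (\<delta>\<^sup>2))))" by simp
    hence "Re (sg a \<epsilon>) * Re (sg a p) = Re (sg a y) * Re (sg a y) * Re (sg a (- (\<delta>\<^sup>2)))"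
      using epsF xy delta_sq by (simp only: Rm F_mult F_minus p_in_F)
    moreover have "Re (sg a (- (\<delta>\<^sup>2))) > 0"
      using delta_sq_totally_negative[OF a] delta_sq a by (simp add: sg_minus)
    moreover have "Re (sg a y) \<noteq> 0" using sg_nonzero[OF a xy(2) y0] sg_real[OF a xy(2)] by auto
    hence "Re (sg a y) * Re (sg a y) > 0" by (simp add: zero_less_mult_iff) linarith
    ultimately have "Re (sg a \<epsilon>) * Re (sg a p) > 0" by simp
    thus "Re (sg a \<epsilon>) > 0" using Re_sg_p_pos[OF a] by (simp add: zero_less_mult_iff)
  qed
  moreover have "alg_unit \<epsilon>" unfolding \<epsilon>_def by (rule alg_unit_minus[OF q(3)])
  ultimately obtain \<eta> where eta: "\<eta> \<in> F" "\<epsilon> = \<eta>\<^sup>2" using totally_positive_unit_square epsF by blast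
  have eta0: "\<eta> \<noteq> 0" using eta q by (auto simp: \<epsilon>_def)
  have "(q / \<eta>)\<^sup>2 = q\<^sup>2 / \<epsilon>" by (simp add: power_divide eta)
  also have "\<dots> = - p" using q(2) by (simp add: \<epsilon>_def)
  also have "\<dots> = (csqrt (- p))\<^sup>2" by simp
  finally have cs: "q / \<eta> = csqrt (- p) \<or> q / \<eta> = - csqrt (- p)" by (simp only: power2_eq_iff)
  let ?M = "field_gen (insert (csqrt (- p)) F)"
  note M = subfield_closed[OF is_subfield_field_gen[of "insert (csqrt (- p)) F"]]
  have inM: "csqrt (- p) \<in> ?M" "F \<subseteq> ?M" using field_gen_incl by blast+
  have "q / \<eta> \<in> L" using q eta F_in_L by (intro L_closed)
  hence "csqrt (- p) \<in> L" using cs L_closed(5)[of "q / \<eta>"] by auto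
  hence "?M \<subseteq> L" using F_in_L by (intro field_gen_least[OF L_field]) auto
  moreover have "q / \<eta> \<in> ?M" using cs inM M(5) by auto
  hence "q / \<eta> * \<eta> / y \<in> ?M" using eta(1) xy(2) inM(2) M(4)[of "q / \<eta>" \<eta>] M(8)[of _ y] by blast
  hence "\<delta> \<in> ?M" using eta0 y0 by (simp add: qd)
  hence "L \<subseteq> ?M" unfolding L_eq using inM(2) M(3,4) by blast
  ultimately show ?thesis by blast
qed

end

text \<open>The unit condition states elementwise that \<open>p\<close> generates the square of the
  ideal of \<open>q\<close>. The locale is used for the given generator and then again for an
  arbitrary one.\<close>

locale ramified_generator = totally_complex_quadratic +
  fixes q :: complex
  assumes q_L: "q \<in> L" and q_unit: "alg_unit (q\<^sup>2 / p)"
begin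

lemma q_nz [simp]: "q \<noteq> 0"
  using alg_unit_nonzero[OF q_unit] by auto

lemma q_int: "algebraic_int q"
proof -
  have "algebraic_int (q\<^sup>2 / p * p)" using alg_unit_algebraic_int[OF q_unit] by blast
  hence "algebraic_int (q\<^sup>2)" by simp
  thus ?thesis by (rule algebraic_int_of_power) simp
qed

lemma p_div_q2_int: "algebraic_int (p / q\<^sup>2)"
  using alg_unit_inverse[OF q_unit] alg_unit_algebraic_int by fastforce

lemma p_div_q_int: "algebraic_int (p / q)"
proof -
  have "algebraic_int (p / q\<^sup>2 * q)" using p_div_q2_int q_int by blast
  thus ?thesis by (simp add: power2_eq_square)
qed

lemma not_algebraic_int_inverse_q: "\<not> algebraic_int (1 / q)"
proof
  assume "algebraic_int (1 / q)"
  hence "algebraic_int (1 / q * (1 / q) * (q\<^sup>2 / p))" using alg_unit_algebraic_int[OF q_unit] by blast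
  moreover have "1 / q * (1 / q) * (q\<^sup>2 / p) = 1 / p" by (simp add: power2_eq_square)
  ultimately show False using not_algebraic_int_inverse_p by simp
qed

text \<open>The residue of \<open>x\<close> modulo \<open>p\<close> is 0 or 1, and residue 1 would
  make \<open>q\<close> a divisor of 1.\<close>

lemma Ou_q_dvd_imp_p_dvd:
  assumes "x \<in> Ou" "algebraic_int (x / q)"
  shows "algebraic_int (x / p)"
  using assms(1)
proof (cases rule: Ou_residue)
  case 2
  have "algebraic_int (x / q - (x - 1) / p * (p / q))" using assms(2) 2 p_div_q_int by blast
  moreover have "x / q - (x - 1) / p * (p / q) = 1 / q" by (simp add: field_simps)
  ultimately show ?thesis using not_algebraic_int_inverse_q by simp
qed

section \<open>The unit \<open>u\<close> is a root of unity of 2-power order\<close>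

definition u :: complex where "u = tau q / q"

lemma u_L: "u \<in> L"
  unfolding u_def using q_L tau_in_L L_closed(8) by blast

lemma u_unit: "alg_unit u"
proof -
  have wL: "q\<^sup>2 / p \<in> L" using q_L F_in_L by (intro L_closed) auto
  have "tau (q\<^sup>2) = tau (q\<^sup>2 / p * p)" by simp
  also have "\<dots> = tau (q\<^sup>2 / p) * p" using wL F_in_L by (subst tau_mult) (auto simp: tau_F)
  finally have "(tau q)\<^sup>2 = tau (q\<^sup>2 / p) * p" using q_L by (simp add: tau_power)
  hence "u\<^sup>2 = tau (q\<^sup>2 / p) / (q\<^sup>2 / p)" by (simp add: u_def power_divide)
  hence "alg_unit (u\<^sup>2)" using alg_unit_divide[OF alg_unit_tau[OF wL q_unit] q_unit] by simp
  thus ?thesis by (rule alg_unit_of_power) simp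
qed

lemma u_norm: "u * tau u = 1"
proof -
  have "tau u * tau q = tau (u * q)" using u_L q_L by (simp add: tau_mult)
  also have "u * q = tau q" by (simp add: u_def)
  finally have "tau u * tau q = q" using q_L by (simp add: tau_tau)
  thus ?thesis using tau_nonzero[OF q_L] by (simp add: u_def field_simps)
qed

lemma u_cong_1: "algebraic_int ((u - 1) / q)"
proof -
  let ?T = "q + tau q"
  have T: "?T \<in> Ou" by (rule trace_in_Ou[OF q_L q_int])
  have "?T / q = 1 + u" by (simp add: u_def add_divide_distrib)
  hence "algebraic_int (?T / q)" using alg_unit_algebraic_int[OF u_unit] by auto
  hence "algebraic_int (?T / p)" by (rule Ou_q_dvd_imp_p_dvd[OF T])
  \<comment> \<open>Being divisible by \<open>p\<close>, the trace is divisible by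
    \<open>q\<^sup>2\<close>, so \<open>q\<close> divides \<open>1 + u\<close>; it also divides
    2.\<close>
  hence "algebraic_int (?T / p * (p / q\<^sup>2) - 2 / p * (p / q))"
    using p_div_q2_int p_div_q_int algebraic_int_2_div_p by blast
  moreover have "?T / p * (p / q\<^sup>2) - 2 / p * (p / q) = (u - 1) / q"
    by (simp add: u_def field_simps power2_eq_square)
  ultimately show ?thesis by simp
qed

text \<open>Otherwise \<open>q\<close> lies in \<open>F\<close>, and 1 is \<open>p\<close> times a
  unit times the square of \<open>inverse q\<close>, against the parity of the valuation.\<close>

lemma u_not_1: "u \<noteq> 1"
proof
  assume "u = 1"
  hence "tau q = q" by (simp add: u_def field_simps)
  hence qF: "q \<in> F" using tau_fixed_iff[OF q_L] by simp
  have "p * (q\<^sup>2 / p) * (inverse q)\<^sup>2 = of_int 1 / of_int 1" by (simp add: field_simps)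
  moreover have "q\<^sup>2 / p \<in> F" using qF by (intro F_intros) auto
  ultimately show False
    using p_unit_square_not_rational[OF q_unit, of "inverse q" 1 1] qF F_inverse by simp
qed

lemma u_power_cong_1: "algebraic_int ((u ^ k - 1) / q)"
proof -
  have "algebraic_int ((u - 1) / q * (\<Sum>i<k. u ^ i))"
    using u_cong_1 alg_unit_algebraic_int[OF u_unit] by blast
  moreover have "(u - 1) / q * (\<Sum>i<k. u ^ i) = (u ^ k - 1) / q"
    using power_diff_1_eq[of u k] by (cases "k = 0") (auto simp: field_simps)
  ultimately show ?thesis by simp
qed

text \<open>Let \<open>v\<close> be the power of \<open>u\<close> with \<open>v ^ k = 1\<close>,
  \<open>k\<close> odd. If \<open>v\<close> is not 1, the sum of the \<open>v ^ i\<close> for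
  \<open>i < k\<close> is 0; each term is 1 modulo \<open>q\<close>, so \<open>q\<close> divides the
  odd number \<open>k\<close>. Hence some \<open>u ^ (2 ^ t)\<close> is 1, and one step before the
  least such \<open>t\<close> the value is -1.\<close>

lemma u_two_power_order: obtains b where "u ^ (2 ^ b) = -1"
proof -
  obtain N where N: "N > 0" "u ^ N = 1"
    using norm_one_root_of_unity[OF u_L u_norm alg_unit_algebraic_int[OF u_unit]] by blast
  define t where "t = multiplicity 2 N"
  obtain k where k: "N = 2 ^ t * k" "odd k"
    unfolding t_def using multiplicity_decompose'[of N 2] N by auto
  define v where "v = u ^ (2 ^ t)"
  have vk: "v ^ k = 1" using N k by (simp add: v_def flip: power_mult)
  have "v = 1"
  proof (rule ccontr)
    assume v1: "v \<noteq> 1"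
    have "(v - 1) * (\<Sum>i<k. v ^ i) = 0" using vk power_diff_1_eq[of v k] k(2) by (cases "k = 0") auto
    hence s0: "(\<Sum>i<k. v ^ i) = 0" using v1 by simp
    have "algebraic_int (\<Sum>i<k. (v ^ i - 1) / q)"
      unfolding v_def by (intro algebraic_int_sum) (simp only: u_power_cong_1 flip: power_mult)
    also have "(\<Sum>i<k. (v ^ i - 1) / q) = - (of_int (int k) / q)"
      by (simp add: s0 sum_subtractf flip: sum_divide_distrib)
    finally have "algebraic_int (of_int (int k) / q)" by (simp only: algebraic_int_minus_iff)
    hence "algebraic_int (of_int (int k) / p)" by (rule Ou_q_dvd_imp_p_dvd[OF Ou_of_int])
    hence "even (int k)" by (rule even_if_p_dvd)
    thus False using k(2) by simp
  qed
  hence "\<exists>t. u ^ (2 ^ t) = 1" unfolding v_def by blast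
  then obtain t' where t': "u ^ (2 ^ t') = 1" "\<And>i. i < t' \<Longrightarrow> u ^ (2 ^ i) \<noteq> 1"
    using exists_least_iff[of "\<lambda>t. u ^ (2 ^ t) = 1"] by blast
  have "t' \<noteq> 0" using t'(1) u_not_1 by (intro notI) simp
  then obtain b where b: "t' = Suc b" by (cases t') auto
  have "(u ^ (2 ^ b))\<^sup>2 = 1" using t'(1) by (simp add: b mult.commute flip: power_mult)
  hence "u ^ (2 ^ b) = -1" using t'(2)[of b] b by (simp add: power2_eq_1_iff)
  thus ?thesis by (rule that)
qed

theorem L_cases: "L = field_gen {\<zeta>} \<or> L = field_gen (insert (csqrt (- p)) F)"
proof -
  obtain b where b: "u ^ (2 ^ b) = -1" by (rule u_two_power_order)
  show ?thesis
  proof (cases b)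
    case 0
    hence "tau q = - q" using b by (simp add: u_def field_simps)
    thus ?thesis using csqrt_case q_L q_unit by simp
  next
    case (Suc b')
    have "(u ^ (2 ^ b'))\<^sup>2 = -1" using b by (simp add: Suc mult.commute flip: power_mult)
    hence "u ^ (2 ^ b') = \<i> \<or> u ^ (2 ^ b') = - \<i>" by (metis i_squared power2_eq_iff power2_i)
    moreover have "u ^ (2 ^ b') \<in> L" using u_L by (rule L_closed)
    ultimately have "\<i> \<in> L" using L_closed(5)[of "u ^ (2 ^ b')"] by auto
    thus ?thesis using ii_in_L_imp by blast
  qed
qed

section \<open>The ring of integers of \<open>L\<close>\<close>

lemma two_div_one_minus_u_int: "algebraic_int (2 / (1 - u))"
proof -
  obtain b where b: "u ^ (2 ^ b) = -1" by (rule u_two_power_order)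
  have "2 = (1 - u) * (\<Sum>i<2 ^ b. u ^ i)" using one_diff_power_eq[of u "2 ^ b"] b by simp
  hence "2 / (1 - u) = (\<Sum>i<2 ^ b. u ^ i)" using u_not_1 by (simp add: field_simps)
  thus ?thesis using alg_unit_algebraic_int[OF u_unit] by (simp only:) blast
qed

text \<open>Since \<open>a \<in> Ou\<close> divisible by \<open>q\<close> is divisible by \<open>q\<^sup>2\<close>, the terms \<open>a\<close> and \<open>b q\<close> cannot cancel.\<close>

lemma p_power_descent:
  assumes "a \<in> Ou" "b \<in> Ou" "algebraic_int ((a + b * q) / p ^ k)"
  shows "a / p ^ k \<in> Ou \<and> b / p ^ k \<in> Ou"
  using assms
proof (induction k arbitrary: a b)
  case (Suc k)
  note a = Suc.prems(1) and b = Suc.prems(2)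
  have int: "algebraic_int a" "algebraic_int b" using a b Ou_algebraic_int by auto
  have "algebraic_int ((a + b * q) / p ^ Suc k * p ^ k)" using Suc.prems(3) by blast
  hence abp: "algebraic_int ((a + b * q) / p)" by simp
  hence "algebraic_int ((a + b * q) / p * (p / q) - b)" using p_div_q_int int by blast
  moreover have "(a + b * q) / p * (p / q) - b = a / q" by (simp add: field_simps)
  ultimately have "algebraic_int (a / q)" by simp
  hence ap: "algebraic_int (a / p)" by (rule Ou_q_dvd_imp_p_dvd[OF a])
  hence "algebraic_int (((a + b * q) / p - a / p) * (p / q\<^sup>2))" using abp p_div_q2_int by blast
  moreover have "((a + b * q) / p - a / p) * (p / q\<^sup>2) = b / q"
    by (simp add: field_simps power2_eq_square)
  ultimately have "algebraic_int (b / q)" by simp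
  hence bp: "algebraic_int (b / p)" by (rule Ou_q_dvd_imp_p_dvd[OF b])
  have "a / p \<in> Ou" "b / p \<in> Ou"
    using ap bp a b Ou_in_F F_divide p_in_F F_algebraic_int_in_Ou by blast+
  moreover have "algebraic_int ((a / p + b / p * q) / p ^ k)"
    using Suc.prems(3) by (simp add: add_divide_distrib)
  ultimately have "a / p / p ^ k \<in> Ou \<and> b / p / p ^ k \<in> Ou" by (rule Suc.IH)
  thus ?case by (simp add: mult.commute)
qed simp

text \<open>In \<open>F\<close>-coordinates \<open>x = a + b * q\<close>, the difference
  \<open>x - tau x\<close> is \<open>b * q * (1 - u)\<close>. As \<open>1 - u\<close> and
  \<open>q\<close> divide 2, both \<open>4 * a\<close> and \<open>4 * b\<close> are integral;
  \<open>p_power_descent\<close> then removes the 4.\<close>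

lemma integer_in_basis:
  assumes x: "x \<in> L" "algebraic_int x"
  obtains a b where "a \<in> Ou" "b \<in> Ou" "x = a + b * q"
proof -
  obtain y0 y1 where y: "y0 \<in> F" "y1 \<in> F" "q = y0 + y1 * \<delta>" using q_L by (elim L_E)
  obtain x0 x1 where xx: "x0 \<in> F" "x1 \<in> F" "x = x0 + x1 * \<delta>" using x(1) by (elim L_E)
  have tq: "tau q \<noteq> q" using u_not_1 by (auto simp: u_def)
  have y1: "y1 \<noteq> 0" using tq y tau_F[of q] by auto
  define b where "b = x1 / y1"
  define a where "a = x0 - b * y0"
  have ab: "a \<in> F" "b \<in> F" using xx y by (auto simp: a_def b_def intro!: F_intros)
  have xab: "x = a + b * q" using y1 by (simp add: a_def b_def y xx field_simps)
  have "tau x = a + b * tau q"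
    unfolding xab using ab F_in_L q_L by (simp add: tau_add tau_mult tau_F L_closed)
  hence d: "x - tau x = b * q * (1 - u)" by (simp add: xab u_def algebra_simps)
  have "algebraic_int ((x - tau x) * (2 / (1 - u)) * (p / q) * (2 / p))"
    using x algebraic_int_tau two_div_one_minus_u_int p_div_q_int algebraic_int_2_div_p by blast
  also have "(x - tau x) * (2 / (1 - u)) * (p / q) * (2 / p) = 4 * b"
    unfolding d using u_not_1 by simp
  finally have b4: "algebraic_int (4 * b)" .
  hence "algebraic_int (4 * x - 4 * b * q)" using x q_int by blast
  hence a4: "algebraic_int (4 * a)" by (simp add: xab algebra_simps)
  have O4: "4 * a \<in> Ou" "4 * b \<in> Ou"
    using a4 b4 ab F_mult numeral_in_F F_algebraic_int_in_Ou by blast+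
  \<comment> \<open>Up to a unit, \<open>p ^ (m + m)\<close> is 4, so the descent applies to
    \<open>4 * a + 4 * b * q\<close> with this exponent.\<close>
  have "algebraic_int (x * (2 / p ^ m) * (2 / p ^ m))"
    using x algebraic_int_2_div_p_power[of m] by blast
  also have "x * (2 / p ^ m) * (2 / p ^ m) = (4 * a + 4 * b * q) / p ^ (m + m)"
    by (simp add: xab power_add field_simps)
  finally have *: "4 * a / p ^ (m + m) \<in> Ou \<and> 4 * b / p ^ (m + m) \<in> Ou"
    using p_power_descent O4 by blast
  have up: "z \<in> Ou" if "z \<in> F" "4 * z / p ^ (m + m) \<in> Ou" for z
  proof -
    have "algebraic_int (4 * z / p ^ (m + m) * (p ^ m / 2) * (p ^ m / 2))"
      using that Ou_algebraic_int alg_unit_algebraic_int[OF alg_unit_p_power] by blast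
    also have "4 * z / p ^ (m + m) * (p ^ m / 2) * (p ^ m / 2) = z" by (simp add: power_add)
    finally show ?thesis using that F_algebraic_int_in_Ou by blast
  qed
  show ?thesis using that[of a b] up ab * xab by blast
qed

theorem integers_eq_adjoin: "ring_of_integers L = ring_adjoin Ou q"
proof
  show "ring_of_integers L \<subseteq> ring_adjoin Ou q"
  proof
    fix x assume "x \<in> ring_of_integers L"
    hence "x \<in> L" "algebraic_int x" by (auto simp: ring_of_integers_def)
    then obtain a b where ab: "a \<in> Ou" "b \<in> Ou" "x = a + b * q" using integer_in_basis by blast
    have "\<forall>i. coeff [:a, b:] i \<in> Ou" using ab Ou_of_int[of 0] by (auto simp: coeff_pCons split: nat.splits)
    moreover have "x = poly [:a, b:] q" using ab by (simp add: mult.commute)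
    ultimately show "x \<in> ring_adjoin Ou q" unfolding ring_adjoin_def by blast
  qed
  show "ring_adjoin Ou q \<subseteq> ring_of_integers L"
  proof
    fix x assume "x \<in> ring_adjoin Ou q"
    then obtain P where P: "x = poly P q" "\<And>i. coeff P i \<in> Ou" unfolding ring_adjoin_def by blast
    have "algebraic_int x" unfolding P(1) by (rule algebraic_int_poly[OF Ou_algebraic_int[OF P(2)] q_int])
    moreover have "poly P q \<in> L" if "\<And>i. coeff P i \<in> Ou" for P
      using that
    proof (induction P)
      case (pCons a P)
      have "a \<in> Ou" using pCons.prems[of 0] by simp
      moreover have "coeff P i \<in> Ou" for i using pCons.prems[of "Suc i"] by simp
      ultimately show ?case using pCons.IH q_L F_in_L Ou_in_F L_closed by simp
    qed (simp add: L_closed)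
    ultimately show "x \<in> ring_of_integers L" using P by (simp add: ring_of_integers_def)
  qed
qed

text \<open>The norms \<open>A\<close> of \<open>q1\<close> and \<open>B\<close> of \<open>r\<close>
  multiply to \<open>p\<close> times a unit. If \<open>p\<close> divided \<open>B\<close>, then
  \<open>q1\<close> would be a unit; so \<open>p\<close> divides \<open>A\<close>, and
  \<open>r\<close> is a unit.\<close>

lemma divisor_is_generator:
  assumes q1: "q1 \<in> L" "algebraic_int q1" "\<not> algebraic_int (1 / q1)"
    and r: "r \<in> L" "algebraic_int r" and qr: "q = q1 * r"
  shows "alg_unit (q1\<^sup>2 / p)"
proof -
  have nz: "q1 \<noteq> 0" "r \<noteq> 0" using qr q_nz by auto
  define \<epsilon> where "\<epsilon> = q * tau q / p"
  have "\<epsilon> = (q\<^sup>2 / p) * u" by (simp add: \<epsilon>_def u_def power2_eq_square)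
  hence eu: "alg_unit \<epsilon>" using alg_unit_mult[OF q_unit u_unit] by simp
  define A where "A = q1 * tau q1"
  define B where "B = r * tau r"
  have O: "A \<in> Ou" "B \<in> Ou" unfolding A_def B_def using q1 r norm_in_Ou by auto
  have AB: "A * B = p * \<epsilon>" using q1 r by (simp add: A_def B_def \<epsilon>_def qr tau_mult)
  have AB0: "A \<noteq> 0" "B \<noteq> 0" using nz q1 r tau_nonzero by (auto simp: A_def B_def)
  have ie: "algebraic_int (inverse \<epsilon>)" using eu by (simp add: alg_unit_def)
  have e0: "\<epsilon> \<noteq> 0" by (rule alg_unit_nonzero[OF eu])
  have "p_odd B"
  proof (rule ccontr)
    assume "\<not> p_odd B"
    hence "algebraic_int (B / p)" using O by (simp add: p_odd_def)
    hence "algebraic_int (tau q1 * (B / p) * inverse \<epsilon>)" using q1 algebraic_int_tau ie by blast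
    moreover have "tau q1 * (B / p) * inverse \<epsilon> = 1 / q1"
    proof -
      have "tau q1 * B * q1 = p * \<epsilon>" using AB by (simp add: A_def mult_ac)
      thus ?thesis using nz e0 by (simp add: field_simps)
    qed
    ultimately show False using q1(3) by simp
  qed
  moreover have "\<not> p_odd (A * B)"
    unfolding AB p_odd_def using alg_unit_algebraic_int[OF eu] by simp
  ultimately have "\<not> p_odd A" using p_odd_mult by blast
  hence Ap: "algebraic_int (A / p)" using O by (simp add: p_odd_def)
  have "algebraic_int (tau r * (A / p) * inverse \<epsilon>)" using r algebraic_int_tau Ap ie by blast
  moreover have "tau r * (A / p) * inverse \<epsilon> = inverse r"
  proof -
    have "tau r * A * r = p * \<epsilon>" using AB by (simp add: B_def mult_ac)
    thus ?thesis using nz e0 by (simp add: field_simps)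
  qed
  ultimately have "alg_unit r" using r nz by (simp add: alg_unit_def)
  hence "alg_unit (q\<^sup>2 / p / r\<^sup>2)" by (intro alg_unit_divide[OF q_unit] alg_unit_power)
  moreover have "q\<^sup>2 / p / r\<^sup>2 = q1\<^sup>2 / p" using nz by (simp add: qr power_mult_distrib)
  ultimately show ?thesis by simp
qed

end

text \<open>Completing the square in the quadratic equation of \<open>b\<close> over
  \<open>F\<close>.\<close>

lemma (in two_power_cyclotomic) quadratic_ext_delta:
  assumes "quadratic_ext L F"
  obtains \<delta> where "\<delta> \<notin> F" "\<delta>\<^sup>2 \<in> F" "L = {x + y * \<delta> | x y. x \<in> F \<and> y \<in> F}"
proof -
  from assms obtain b where L: "is_subfield L" and b: "b \<in> L" "b \<notin> F"
    and Lb: "L = {x + y * b | x y. x \<in> F \<and> y \<in> F}"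
    unfolding quadratic_ext_def by blast
  have "b\<^sup>2 \<in> L" using b(1) by (rule subfield_closed(9)[OF L])
  then obtain \<alpha> \<beta> where ab: "\<alpha> \<in> F" "\<beta> \<in> F" "b\<^sup>2 = \<alpha> + \<beta> * b" using Lb by auto
  define \<delta> where "\<delta> = b - \<beta> / 2"
  have b2: "\<beta> / 2 \<in> F" using ab by (intro F_divide) auto
  show ?thesis
  proof (rule that[of \<delta>])
    show "\<delta> \<notin> F" using F_add[OF _ b2, of \<delta>] b(2) by (auto simp: \<delta>_def)
    have "\<delta>\<^sup>2 = b\<^sup>2 - \<beta> * b + \<beta>\<^sup>2 / 4" by (simp add: \<delta>_def power2_eq_square field_simps)
    also have "\<dots> = \<alpha> + \<beta>\<^sup>2 / 4" using ab(3) by simp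
    also have "\<dots> \<in> F" using ab by (intro F_intros) auto
    finally show "\<delta>\<^sup>2 \<in> F" .
    show "L = {x + y * \<delta> | x y. x \<in> F \<and> y \<in> F}"
    proof (intro equalityI subsetI)
      fix z assume "z \<in> L"
      then obtain x y where xy: "x \<in> F" "y \<in> F" "z = x + y * b" using Lb by auto
      have "z = (x + y * (\<beta> / 2)) + y * \<delta>" using xy by (simp add: \<delta>_def algebra_simps)
      thus "z \<in> {x + y * \<delta> | x y. x \<in> F \<and> y \<in> F}" using xy F_add F_mult b2 by blast
    next
      fix z assume "z \<in> {x + y * \<delta> | x y. x \<in> F \<and> y \<in> F}"
      then obtain x y where xy: "x \<in> F" "y \<in> F" "z = x + y * \<delta>" by auto
      have "z = (x - y * (\<beta> / 2)) + y * b" using xy by (simp add: \<delta>_def algebra_simps)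
      thus "z \<in> L" unfolding Lb using xy F_diff F_mult b2 by blast
    qed
  qed
qed

theorem theorem4p22:
  fixes s :: nat and L :: "complex set"
  defines "n \<equiv> (2::nat) ^ s"
  defines "\<zeta> \<equiv> exp (2 * of_real pi * \<i> / of_nat n)"
  defines "K \<equiv> field_gen {\<zeta>}"
  defines "F \<equiv> field_gen {\<zeta> + inverse \<zeta>}"
  defines "Ou \<equiv> int_adjoin (\<zeta> + inverse \<zeta>)"
  defines "p \<equiv> 2 + \<zeta> + inverse \<zeta>"
  assumes "n \<ge> 8"
  assumes "quadratic_ext L F" and "totally_complex L"
  assumes "\<exists>q \<in> ring_of_integers L.
             pideal (ring_of_integers L) p = pideal (ring_of_integers L) (q ^ 2)"
  shows "(L = K \<or> L = field_gen (insert (csqrt (- p)) F)) \<and>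
         (\<forall>q \<in> ring_of_integers L.
            prime_ideal_in (ring_of_integers L) (pideal (ring_of_integers L) q) \<and>
            p \<in> pideal (ring_of_integers L) q \<longrightarrow>
            ring_of_integers L = ring_adjoin Ou q)"
proof -
  have s3: "s \<ge> 3"
  proof (rule ccontr)
    assume "\<not> s \<ge> 3"
    hence "s \<le> 2" by simp
    hence "(2::nat) ^ s \<le> 2 ^ 2" by (rule power_increasing) simp
    thus False using assms(7) by (simp add: n_def)
  qed
  then obtain s' where s': "s = Suc s'" by (cases s) auto
  have "\<zeta> ^ (2 ^ (s - 1)) = exp (of_nat (2 ^ s') * (2 * of_real pi * \<i> / of_nat n))"
    by (simp only: \<zeta>_def s' diff_Suc_1 exp_of_nat_mult)
  also have "of_nat (2 ^ s') * (2 * of_real pi * \<i> / of_nat n) = of_real pi * \<i>"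
    by (simp add: n_def s' field_simps)
  finally have "\<zeta> ^ (2 ^ (s - 1)) = -1" by simp
  then interpret C: two_power_cyclotomic s \<zeta> using s3 by unfold_locales
  have c: "\<zeta> + inverse \<zeta> = C.c" by (simp add: C.c_def C.e_def)
  have F: "F = C.F" unfolding F_def c by (rule C.field_gen_c)
  have Ou: "Ou = C.Ou" unfolding Ou_def C.Ou_def c ..
  have p: "p = C.p" unfolding p_def C.p_def c[symmetric] by simp
  have qe: "quadratic_ext L C.F" using assms(8) F by simp
  then obtain \<delta> where d: "\<delta> \<notin> C.F" "\<delta>\<^sup>2 \<in> C.F" "L = {x + y * \<delta> | x y. x \<in> C.F \<and> y \<in> C.F}"
    using C.quadratic_ext_delta by blast
  have "is_subfield L" using qe by (simp add: quadratic_ext_def)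
  then interpret Q: totally_complex_quadratic s \<zeta> L \<delta>
    using d assms(9) by unfold_locales
  let ?R = "ring_of_integers L"
  have R: "x \<in> ?R \<longleftrightarrow> x \<in> L \<and> algebraic_int x" for x by (simp add: ring_of_integers_def)
  have one: "1 \<in> ?R" by (auto simp: R Q.L_closed)
  obtain q0 where q0: "q0 \<in> ?R" "pideal ?R p = pideal ?R (q0\<^sup>2)" using assms(10) by blast
  \<comment> \<open>The equality of ideals becomes mutual divisibility, so
    \<open>q0\<^sup>2 / p\<close> is the unit \<open>r2\<close> with inverse
    \<open>r1\<close>.\<close>
  have "p \<in> pideal ?R p" "q0\<^sup>2 \<in> pideal ?R (q0\<^sup>2)" using one unfolding pideal_def by force+
  hence "p \<in> pideal ?R (q0\<^sup>2)" "q0\<^sup>2 \<in> pideal ?R p" by (simp_all add: q0(2))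
  then obtain r1 r2 where r: "r1 \<in> ?R" "p = q0\<^sup>2 * r1" "r2 \<in> ?R" "q0\<^sup>2 = p * r2"
    unfolding pideal_def by blast
  have p0: "p \<noteq> 0" by (simp add: p)
  hence "q0\<^sup>2 \<noteq> 0" using r(2) by auto
  have r2: "q0\<^sup>2 / p = r2" using r(4) p0 by simp
  have r1: "inverse (q0\<^sup>2 / p) = r1" using r(2) \<open>q0\<^sup>2 \<noteq> 0\<close> by (simp add: field_simps)
  have "q0\<^sup>2 / p \<noteq> 0" using p0 \<open>q0\<^sup>2 \<noteq> 0\<close> by simp
  hence "alg_unit (q0\<^sup>2 / C.p)"
    unfolding alg_unit_def p[symmetric] r1 using r(1,3) R by (simp add: r2)
  moreover have "q0 \<in> L" using q0(1) R by blast
  ultimately interpret G: ramified_generator s \<zeta> L \<delta> q0 by unfold_locales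
  show ?thesis
  proof (intro conjI ballI impI)
    show "L = K \<or> L = field_gen (insert (csqrt (- p)) F)"
      using G.L_cases by (simp add: K_def p F)
  next
    fix q assume q: "q \<in> ?R" and pr: "prime_ideal_in ?R (pideal ?R q) \<and> p \<in> pideal ?R q"
    \<comment> \<open>The prime ideal contains \<open>p\<close>, hence \<open>q0\<^sup>2\<close>,
      hence \<open>q0\<close>; so \<open>q\<close> divides \<open>q0\<close>.\<close>
    have "q0 * q0 \<in> pideal ?R q"
    proof -
      have "r2 * p \<in> pideal ?R q" using pr r(3) unfolding prime_ideal_in_def by blast
      thus ?thesis using r(4) by (simp add: power2_eq_square mult.commute)
    qed
    hence "q0 \<in> pideal ?R q" using pr q0(1) unfolding prime_ideal_in_def by blast
    then obtain t where t: "t \<in> ?R" "q0 = q * t" unfolding pideal_def by blast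
    \<comment> \<open>A prime ideal does not contain 1, so its generator is not a unit.\<close>
    have nt: "\<not> algebraic_int (1 / q)"
    proof
      assume "algebraic_int (1 / q)"
      moreover have "1 / q \<in> L" using q R Q.L_closed(2,8) by blast
      ultimately have "1 / q \<in> ?R" by (simp add: R)
      moreover have "1 = q * (1 / q)" using t G.q_nz by simp
      ultimately have "1 \<in> pideal ?R q" unfolding pideal_def by blast
      thus False using pr by (simp add: prime_ideal_in_def)
    qed
    have "alg_unit (q\<^sup>2 / C.p)"
      using G.divisor_is_generator[of q t] q t nt R by blast
    moreover have "q \<in> L" using q R by blast
    ultimately interpret H: ramified_generator s \<zeta> L \<delta> q by unfold_locales
    show "?R = ring_adjoin Ou q" using H.integers_eq_adjoin by (simp add: Ou)
  qed
qed

end
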